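(* Let $P_{[m]}=(P_1,\dots,P_m)$ be a family of simplicial $d$-polytopes in $\mathbb{R}^d$ in relatively general position, with Cayley complex $T_{[m]}$. Then for every $k$, \[ (k+m)\,g_{k+m}(T^\circ_{[m]})\le(f_0(T_{[m]})-d-m)\,h_{k+m-1}(T^\circ_{[m]})+\sum_{i=1}^mf_0(T_{\{i\}})\,g_{k+m-1}(T^\circ_{[m]\setminus\{i\}}). \] Moreover, one has \[ (i+|S|)\,g_{i+|S|}(T^\circ_S)=(f_0(T_S)-d-|S|)\,h_{i+|S|-1}(T^\circ_S)+\sum_{j\in S}f_0(T_{\{j\}})\,g_{i+|S|-1}(T^\circ_{S\setminus\{j\}}) \] for all $i\le k_0$ and all $S\subseteq[m]$ if and only if, for all $S\subseteq[m]$, every non-face of $T_S$ of dimension $<k_0+|S|$ has its vertex set contained in $V(T_R)$ for some $R\subsetneq S$.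
   Context: Relatively general position: every proper face $F=F_1+\cdots+F_m$ of $P_1+\cdots+P_m$ has $\dim F=\sum\dim F_i$. Cayley polytope $\mathrm{Cay}(P_{[m]})=\mathrm{conv}(\bigcup_iP_i\times\{e_i\})\subseteq\mathbb{R}^{d}\times\mathbb{R}^m$ with projection $\pi$ onto $\mathrm{conv}\{e_1,\dots,e_m\}$; the Cayley complex $T_{[m]}$ is the closure of $\pi^{-1}(\mathrm{relint}\,\mathrm{conv}\{e_i\})\cap\partial\mathrm{Cay}(P_{[m]})$, a simplicial complex of dimension $d+m-2$. For $S\subseteq[m]$, $T_S$ is the Cayley complex of $(P_i)_{i\in S}$ (so $T_{\{i\}}=\partial P_i$), and the relative Cayley complex is $T^\circ_S=(T_S,\bigcup_{i\in S}T_{S\setminus\{i\}})$, with $T^\circ_\emptyset$ the void complex (all its $h,g$ numbers zero). For a relative complex of dimension $D-1$ with $f_j$ the number of $j$-faces of the larger complex not in the smaller, $\sum_{k=0}^Df_{k-1}t^k(1-t)^{D-k}=\sum_kh_kt^k$, and $g_k=h_k-h_{k-1}$; $T^\circ_S$ has $D=d+|S|-1$. $f_0$ counts vertices; a non-face is a vertex subset not in the complex.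
   Formalization: The numbers of T°_∅ are not zero: T_∅ is the complex {∅}, T°_∅ = ({∅}, void) with D = d−1, and T°_{i} is ∂P_i relative to {∅}; with all numbers of T°_∅ zero the claim fails for m = 1 or for two triangles in the plane. *)

theory Defs
  imports "HOL-Analysis.Analysis" "HOL-Computational_Algebra.Polynomial"
begin

section \<open>Polytopes and Cayley complexes\<close>

definition simplicial_polytope :: "'a::euclidean_space set \<Rightarrow> bool" where
  "simplicial_polytope P \<longleftrightarrow>
     polytope P \<and> (\<forall>F. F face_of P \<and> F \<noteq> P \<longrightarrow> (\<exists>n. n simplex F))"

text \<open>Below, \<open>sum P UNIV\<close> is the Minkowski sum.  The empty face is excluded, because its
  dimension is \<open>-1\<close>.  For a nonempty face \<open>F\<close> of a Minkowski sum of polytopes the faces \<open>G i\<close>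
  with \<open>F = (\<Sum>i\<in>UNIV. G i)\<close> exist and are unique.\<close>

definition relatively_general_position ::
    "('m::finite \<Rightarrow> 'a::euclidean_space set) \<Rightarrow> bool" where
  "relatively_general_position P \<longleftrightarrow>
     (\<forall>F G. F face_of sum P UNIV \<and> F \<noteq> {} \<and> F \<noteq> sum P UNIV \<and>
            (\<forall>i. G i face_of P i) \<and> F = (\<Sum>i\<in>UNIV. G i)
        \<longrightarrow> aff_dim F = (\<Sum>i\<in>UNIV. aff_dim (G i)))"

text \<open>For all subfamilies the Cayley polytope is taken in the same ambient space
  \<open>'a \<times> (real^'m)\<close>, so that the complexes of subfamilies are literally subcomplexes.\<close>

definition cayley_polytope ::
    "('m::finite \<Rightarrow> 'a::euclidean_space set) \<Rightarrow> 'm set \<Rightarrow> ('a \<times> (real^'m)) set" where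
  "cayley_polytope P S = convex hull (\<Union>i\<in>S. P i \<times> {axis i 1})"

definition cayley_carrier ::
    "('m::finite \<Rightarrow> 'a::euclidean_space set) \<Rightarrow> 'm set \<Rightarrow> ('a \<times> (real^'m)) set" where
  "cayley_carrier P S =
     closure (snd -` rel_interior (convex hull ((\<lambda>i. axis i 1) ` S))
              \<inter> rel_frontier (cayley_polytope P S))"

text \<open>The faces, including the empty one, of the Cayley polytope that lie in the carrier.
  For \<open>S = {}\<close> this gives the empty complex \<open>{{}}\<close>.\<close>

definition cayley_complex ::
    "('m::finite \<Rightarrow> 'a::euclidean_space set) \<Rightarrow> 'm set \<Rightarrow> ('a \<times> (real^'m)) set set" where
  "cayley_complex P S = {F. F face_of cayley_polytope P S \<and> F \<subseteq> cayley_carrier P S}"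

definition cayley_sub ::
    "('m::finite \<Rightarrow> 'a::euclidean_space set) \<Rightarrow> 'm set \<Rightarrow> ('a \<times> (real^'m)) set set" where
  "cayley_sub P S = (\<Union>i\<in>S. cayley_complex P (S - {i}))"

definition complex_vertices :: "'a::euclidean_space set set \<Rightarrow> 'a set" where
  "complex_vertices \<Delta> = {v. {v} \<in> \<Delta>}"

text \<open>A face is identified with its vertex set.  The dimension of a vertex set \<open>\<sigma>\<close> is
  \<open>card \<sigma> - 1\<close>.\<close>

definition non_face :: "'a::euclidean_space set set \<Rightarrow> 'a set \<Rightarrow> bool" where
  "non_face \<Delta> \<sigma> \<longleftrightarrow>
     \<sigma> \<subseteq> complex_vertices \<Delta> \<and> \<not> (\<exists>F\<in>\<Delta>. {v. v extreme_point_of F} = \<sigma>)"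

section \<open>Face numbers of relative complexes\<close>

text \<open>For a relative complex \<open>(\<Delta>, \<Gamma>)\<close>; the absolute case is \<open>\<Gamma> = {}\<close>.\<close>

definition f_num :: "'a::euclidean_space set set \<Rightarrow> 'a set set \<Rightarrow> int \<Rightarrow> int" where
  "f_num \<Delta> \<Gamma> j = int (card {F \<in> \<Delta> - \<Gamma>. aff_dim F = j})"

definition h_poly :: "nat \<Rightarrow> 'a::euclidean_space set set \<Rightarrow> 'a set set \<Rightarrow> int poly" where
  "h_poly D \<Delta> \<Gamma> = (\<Sum>k\<le>D. monom (f_num \<Delta> \<Gamma> (int k - 1)) k * [:1, -1:] ^ (D - k))"

definition h_num :: "nat \<Rightarrow> 'a::euclidean_space set set \<Rightarrow> 'a set set \<Rightarrow> int \<Rightarrow> int" where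
  "h_num D \<Delta> \<Gamma> k = (if k < 0 then 0 else coeff (h_poly D \<Delta> \<Gamma>) (nat k))"

definition g_num :: "nat \<Rightarrow> 'a::euclidean_space set set \<Rightarrow> 'a set set \<Rightarrow> int \<Rightarrow> int" where
  "g_num D \<Delta> \<Gamma> k = h_num D \<Delta> \<Gamma> k - h_num D \<Delta> \<Gamma> (k - 1)"

definition cayley_f0 :: "('m::finite \<Rightarrow> 'a::euclidean_space set) \<Rightarrow> 'm set \<Rightarrow> int" where
  "cayley_f0 P S = f_num (cayley_complex P S) {} 0"

definition cayley_h :: "('m::finite \<Rightarrow> 'a::euclidean_space set) \<Rightarrow> 'm set \<Rightarrow> int \<Rightarrow> int" where
  "cayley_h P S = h_num (DIM('a) + card S - 1) (cayley_complex P S) (cayley_sub P S)"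

definition cayley_g :: "('m::finite \<Rightarrow> 'a::euclidean_space set) \<Rightarrow> 'm set \<Rightarrow> int \<Rightarrow> int" where
  "cayley_g P S = g_num (DIM('a) + card S - 1) (cayley_complex P S) (cayley_sub P S)"

section \<open>The convention for the empty subfamily\<close>

text \<open>The complex of the empty subfamily is the empty complex \<open>{{}}\<close>.  Hence the relative complex
  of a single polytope is its boundary complex relative to \<open>{{}}\<close>, and that of the empty subfamily
  is \<open>({{}}, {})\<close> with \<open>D = d - 1\<close>.

  The alternative convention is to let \<open>h\<close> and \<open>g\<close> vanish for the empty subfamily and to use the
  absolute boundary complex for a single polytope.  The \<open>g\<close>-numbers of the empty subfamily enter
  only the relation for a single polytope and the one for \<open>S = {}\<close>.  For a single polytope, the
  difference of the two sides is the same in both conventions (\<open>singleton_recursion_absolute\<close>);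
  for \<open>S = {}\<close> the relation holds in both.

  In the relation for a pair, however, the boundary complexes of the members must be taken relative
  to \<open>{{}}\<close>: for two triangles in the plane without parallel edges there are six mixed edges, so the
  inequality at \<open>k = 0\<close> is \<open>2 * 6 \<le> 3 * 3 + 3 * 3\<close>, but with the absolute boundary complexes it
  would be \<open>2 * 6 \<le> 3 * 0 + 3 * 0\<close>.\<close>

lemma cayley_complex_empty: "cayley_complex P {} = {{}}"
  by (auto simp: cayley_complex_def cayley_polytope_def)

lemma cayley_sub_empty: "cayley_sub P {} = {}"
  by (simp add: cayley_sub_def)

lemma cayley_sub_singleton: "cayley_sub P {i} = {{}}"
  by (simp add: cayley_sub_def cayley_complex_empty)

lemma f_num_empty_complex:
  "f_num {{} :: 'a::euclidean_space set} {} j = (if j = -1 then 1 else 0)"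
proof -
  have "{F \<in> {{} :: 'a set} - {}. aff_dim F = j} = (if j = -1 then {{}} else {})" by auto
  then have "card {F \<in> {{} :: 'a set} - {}. aff_dim F = j} = (if j = -1 then 1 else 0)"
    by (simp only: if_distrib[of card] card.empty) simp
  then show ?thesis by (simp only: f_num_def) simp
qed

lemma f_num_rel_empty:
  fixes \<Delta> :: "'a::euclidean_space set set"
  assumes "finite \<Delta>" "{} \<in> \<Delta>"
  shows "f_num \<Delta> {{}} j = f_num \<Delta> {} j - f_num {{} :: 'a set} {} j"
proof (cases "j = -1")
  case True
  have "{F \<in> \<Delta> - {{}}. aff_dim F = j} = {}" 
    using True by (auto simp: aff_dim_empty[symmetric])
  moreover have "{F \<in> \<Delta> - {}. aff_dim F = j} = {{}}" 
    using True assms by (auto simp: aff_dim_empty[symmetric])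
  ultimately show ?thesis unfolding f_num_empty_complex unfolding f_num_def
    using True by (simp only:) simp
next
  case False
  then have "{F \<in> \<Delta> - {{}}. aff_dim F = j} = {F \<in> \<Delta> - {}. aff_dim F = j}" by auto
  then show ?thesis unfolding f_num_empty_complex unfolding f_num_def using False by simp
qed

lemma h_num_rel_empty:
  fixes \<Delta> :: "'a::euclidean_space set set"
  assumes "finite \<Delta>" "{} \<in> \<Delta>"
  shows "h_num D \<Delta> {{}} k = h_num D \<Delta> {} k - h_num D {{} :: 'a set} {} k"
proof -
  have "h_poly D \<Delta> {{}} = h_poly D \<Delta> {} - h_poly D {{} :: 'a set} {}"
    unfolding h_poly_def
    by (simp only: f_num_rel_empty[OF assms] diff_monom[symmetric] left_diff_distrib sum_subtractf)
  then show ?thesis by (simp add: h_num_def)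
qed

lemma h_poly_empty_complex: "h_poly D {{}} {} = [:1, -1:] ^ D"
proof -
  have "h_poly D {{}} {} = (\<Sum>k\<le>D. if k = 0 then [:1, -1:] ^ D else 0)"
    unfolding h_poly_def by (intro sum.cong) (auto simp: f_num_empty_complex)
  then show ?thesis by simp
qed

lemma empty_complex_recursion:
  assumes "d \<ge> 1"
  shows "(k + 1) * g_num d {{} :: 'a::euclidean_space set} {} (k + 1) =
           (n - int d - 1) * h_num d {{} :: 'a set} {} k - n * g_num (d - 1) {{} :: 'a set} {} k"
proof (cases "k < 0")
  case True
  then show ?thesis by (cases "k = -1") (auto simp: g_num_def h_num_def)
next
  case False
  then obtain j where k: "k = int j" by (metis nonneg_int_cases not_less)
  define q :: "int poly" where "q = [:1, -1:]"
  obtain e where d: "d = Suc e" using assms by (cases d) auto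
  have "pderiv (q ^ d) = smult (int d) (q ^ e) * pderiv q"
    unfolding d by (rule pderiv_power_Suc)
  moreover have "pderiv q = [:-1:]" by (simp add: q_def pderiv_pCons)
  ultimately have "q * pderiv (q ^ d) = smult (- int d) (q ^ d)" by (simp add: d)
  then have "coeff (q * pderiv (q ^ d)) j = - int d * coeff (q ^ d) j" by simp
  then have a: "(int j + 1) * coeff (q ^ d) (Suc j) - int j * coeff (q ^ d) j =
      - int d * coeff (q ^ d) j"
    by (cases j) (auto simp: q_def coeff_pderiv algebra_simps)
  have "coeff (q ^ d) j = coeff (q * q ^ e) j" by (simp add: d)
  then have b: "coeff (q ^ d) j = coeff (q ^ e) j - (if j = 0 then 0 else coeff (q ^ e) (j - 1))"
    by (cases j) (auto simp: q_def)
  have g: "g_num (d - 1) {{} :: 'a set} {} k = coeff (q ^ d) j"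
    using b by (auto simp: d g_num_def h_num_def h_poly_empty_complex k q_def nat_diff_distrib)
  have g': "g_num d {{} :: 'a set} {} (k + 1) = coeff (q ^ d) (Suc j) - coeff (q ^ d) j"
    by (simp add: g_num_def h_num_def h_poly_empty_complex k q_def nat_add_distrib)
  have h: "h_num d {{} :: 'a set} {} k = coeff (q ^ d) j"
    by (simp add: h_num_def h_poly_empty_complex k q_def)
  show ?thesis unfolding g g' h using a by (simp add: k algebra_simps)
qed

lemma singleton_recursion_absolute:
  fixes P :: "'m::finite \<Rightarrow> 'a::euclidean_space set" and i :: 'm
  defines "\<Delta> \<equiv> cayley_complex P {i}"
  assumes "polytope (P i)"
  shows "(k + 1) * cayley_g P {i} (k + 1) -
           ((n - int DIM('a) - 1) * cayley_h P {i} k + n * cayley_g P {} k) =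
         (k + 1) * g_num DIM('a) \<Delta> {} (k + 1) - (n - int DIM('a) - 1) * h_num DIM('a) \<Delta> {} k"
proof -
  have "cayley_polytope P {i} = P i \<times> {axis i 1}"
    using assms(2) by (simp add: cayley_polytope_def hull_same polytope_imp_convex convex_Times)
  then have "polytope (cayley_polytope P {i})"
    using assms(2) by (simp add: polytope_Times polytope_sing)
  then have "finite {F. F face_of cayley_polytope P {i}}" by (rule finite_polytope_faces)
  then have fin: "finite \<Delta>"
    by (rule rev_finite_subset) (auto simp: \<Delta>_def cayley_complex_def)
  have emp: "{} \<in> \<Delta>" by (simp add: \<Delta>_def cayley_complex_def)
  let ?E = "{{} :: ('a \<times> (real^'m)) set}"
  have "DIM('a) \<ge> 1" using DIM_positive[where 'a='a] by linarith
  note E = empty_complex_recursion[OF this, of k n, where 'a="'a \<times> (real^'m)"]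
  have h: "cayley_h P {i} l = h_num DIM('a) \<Delta> {} l - h_num DIM('a) ?E {} l" for l
    using h_num_rel_empty[OF fin emp] by (simp add: cayley_h_def cayley_sub_singleton \<Delta>_def)
  have g: "cayley_g P {i} l = g_num DIM('a) \<Delta> {} l - g_num DIM('a) ?E {} l" for l
    using h_num_rel_empty[OF fin emp]
    by (simp add: cayley_g_def g_num_def cayley_sub_singleton \<Delta>_def)
  have "cayley_g P {} k = g_num (DIM('a) - 1) ?E {} k"
    by (simp add: cayley_g_def cayley_complex_empty cayley_sub_empty)
  with E show ?thesis unfolding g h by (simp add: right_diff_distrib)
qed

end

theory Submission
  imports Defs
begin

text \<open>Lift the vertices of \<open>P j\<close> to the vectors \<open>(v, e\<^sub>j)\<close>.  Let \<open>Q\<close> be the faces of \<open>T\<^sub>S\<close> that use all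
  colours of \<open>S\<close> except possibly \<open>i\<close>; its \<open>h\<close>-polynomial is
  \<open>h(T\<degree>\<^sub>S) + (1 - t) h(T\<degree>\<^bsub>S - i\<^esub>)\<close>.  For a vertex \<open>v\<close> of colour \<open>i\<close>, a generic line starting
  near \<open>v\<close> meets the hyperplane of a facet \<open>F\<close> in a combination of the vertices of \<open>F\<close> without
  zero coefficients; let \<open>R F\<close> be the vertices with negative coefficient.  As in a line shelling,
  \<open>Q\<close> is the disjoint union of the intervals from \<open>R F\<close> to \<open>F\<close>, and \<open>v\<close> is in no \<open>R F\<close> with
  \<open>v \<in> F\<close>.  So \<open>h\<^sub>k(Q)\<close> counts the \<open>F\<close> with \<open>card (R F) = k\<close>, and \<open>h\<^sub>k\<close> of the link of \<open>v\<close> counts those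
  of them that contain \<open>v\<close>.  Summing the differences over \<open>v\<close> gives the inequality, because the
  sum of the link polynomials is \<open>(1 - t) h' + D h\<close>; equality up to \<open>k\<close> means that \<open>\<sigma> \<union> {v}\<close> is a
  face for every \<open>\<sigma>\<close> in \<open>Q\<close> with at most \<open>k\<close> vertices.\<close>

section \<open>Interval partitions and h-polynomials\<close>

text \<open>The Cayley complex is only part of the boundary of the Cayley polytope: the preimages of
  faces of the simplex, exposed by functionals with \<open>fst y = 0\<close>, are missing, so a line
  shelling of the whole boundary does not partition it. The colour coordinates of the line repair
  this. Where the line meets the hyperplane of a facet F, its coordinates of colours other than i
  are negative, which forces \<open>R F\<close> to contain a vertex of each of these colours. Its
  coordinate of colour i is positive at the facets that matter, which keeps the missing faces out of
  the argument.

  The constant d + |S| is D + 1 for D = d + |S| - 1: coefficient K of the sum of the links is (K+1)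
  h_{K+1} + (D-K) h_K, and f_0 h_K minus this is (f_0 - D - 1) h_K - (K+1) g_{K+1}. The remaining
  g-numbers arise because multiplication by 1 - t takes differences of coefficients.

  General position is converted by a dimension count into linear independence of the lifted vertices
  of a face; the later arguments about facets are linear algebra with functionals.\<close>

definition face_poly :: "nat \<Rightarrow> 'x set set \<Rightarrow> int poly" where
  "face_poly D \<A> = (\<Sum>\<sigma>\<in>\<A>. monom 1 (card \<sigma>) * [:1, -1:] ^ (D - card \<sigma>))"

text \<open>The h-polynomial of the link of \<open>v\<close>, written over the faces that contain
  \<open>v\<close>: passing to \<sigma> - {v} lowers both \<open>card \<sigma>\<close> and D by one,
  so the exponent \<open>D - card \<sigma>\<close> stays.\<close>

definition star_poly :: "nat \<Rightarrow> 'x set set \<Rightarrow> 'x \<Rightarrow> int poly" where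
  "star_poly D \<A> v =
     (\<Sum>\<sigma> | \<sigma> \<in> \<A> \<and> v \<in> \<sigma>. monom 1 (card \<sigma> - 1) * [:1, -1:] ^ (D - card \<sigma>))"

text \<open>With t^|R| taken out, the sum runs over the subsets \<tau> of F - R, and t^|\<tau>|
  (1-t)^|F - R - \<tau>| is the general term in the expansion of a product of |F - R| factors t + (1
  - t) = 1.\<close>

lemma face_poly_interval:
  assumes "finite F" "R \<subseteq> F"
  shows "face_poly (card F) {\<sigma>. R \<subseteq> \<sigma> \<and> \<sigma> \<subseteq> F} = monom 1 (card R)"
proof -
  let ?t = "monom 1 1 :: int poly" and ?q = "[:1, -1:] :: int poly"
  have "face_poly (card F) {\<sigma>. R \<subseteq> \<sigma> \<and> \<sigma> \<subseteq> F} =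
      (\<Sum>\<tau>\<in>Pow (F - R). ?t ^ card R * (?t ^ card \<tau> * ?q ^ card (F - R - \<tau>)))"
    unfolding face_poly_def
  proof (rule sum.reindex_bij_witness[of _ "\<lambda>\<tau>. R \<union> \<tau>" "\<lambda>\<sigma>. \<sigma> - R"])
    fix \<sigma> assume \<sigma>: "\<sigma> \<in> {\<sigma>. R \<subseteq> \<sigma> \<and> \<sigma> \<subseteq> F}"
    then have "finite \<sigma>" "finite R" using assms by (auto intro: finite_subset)
    then have "card \<sigma> = card R + card (\<sigma> - R)"
      using \<sigma> by (simp add: card_Diff_subset card_mono)
    moreover have "card (F - R - (\<sigma> - R)) = card F - card \<sigma>"
    proof -
      have "F - R - (\<sigma> - R) = F - \<sigma>" using \<sigma> by auto
      then show ?thesis using \<sigma> \<open>finite \<sigma>\<close> by (simp add: card_Diff_subset)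
    qed
    moreover have "monom (1::int) (a + b) = ?t ^ a * ?t ^ b" for a b
      by (simp add: monom_altdef power_add)
    ultimately show "?t ^ card R * (?t ^ card (\<sigma> - R) * ?q ^ card (F - R - (\<sigma> - R))) =
        monom 1 (card \<sigma>) * ?q ^ (card F - card \<sigma>)"
      by (metis mult.assoc)
  qed (use assms in auto)
  also have "\<dots> = ?t ^ card R * (\<Sum>\<tau>\<in>Pow (F - R). (\<Prod>x\<in>\<tau>. ?t) * (\<Prod>x\<in>F - R - \<tau>. ?q))"
    by (simp add: sum_distrib_left)
  also have "\<dots> = ?t ^ card R * (\<Prod>x\<in>F - R. ?t + ?q)"
    using assms by (subst prod_add) auto
  also have "?t + ?q = 1" by (simp add: monom_altdef one_pCons)
  finally show ?thesis by (simp add: monom_altdef)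
qed

text \<open>Deleting \<open>v\<close> maps the faces through \<open>v\<close> bijectively to the
  interval from R to F - {v}. The lower end stays R because \<open>v\<close> is not in R, so a facet
  through \<open>v\<close> contributes the same monomial to the link as to the whole.\<close>

lemma star_poly_interval:
  assumes "finite F" "R \<subseteq> F" "v \<in> F" "v \<notin> R"
  shows "star_poly (card F) {\<sigma>. R \<subseteq> \<sigma> \<and> \<sigma> \<subseteq> F} v = monom 1 (card R)"
proof -
  have "star_poly (card F) {\<sigma>. R \<subseteq> \<sigma> \<and> \<sigma> \<subseteq> F} v =
      face_poly (card (F - {v})) {\<tau>. R \<subseteq> \<tau> \<and> \<tau> \<subseteq> F - {v}}"
    unfolding face_poly_def star_poly_def
  proof (rule sum.reindex_bij_witness[of _ "insert v" "\<lambda>\<sigma>. \<sigma> - {v}"])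
    fix \<sigma> assume \<sigma>: "\<sigma> \<in> {\<sigma>. \<sigma> \<in> {\<sigma>. R \<subseteq> \<sigma> \<and> \<sigma> \<subseteq> F} \<and> v \<in> \<sigma>}"
    then have "finite \<sigma>" using assms by (auto intro: finite_subset)
    then have "card (\<sigma> - {v}) = card \<sigma> - 1" "card \<sigma> > 0" using \<sigma> by (auto simp: card_gt_0_iff)
    moreover have "card (F - {v}) = card F - 1" using assms by simp
    ultimately show "monom 1 (card (\<sigma> - {v})) * [:1, -1:] ^ (card (F - {v}) - card (\<sigma> - {v})) =
        monom 1 (card \<sigma> - 1) * [:1, -1::int:] ^ (card F - card \<sigma>)"
      by simp
  qed (use assms in auto)
  also have "\<dots> = monom 1 (card R)" by (rule face_poly_interval) (use assms in auto)
  finally show ?thesis .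
qed

text \<open>A partition of a relative complex into Boolean intervals. The condition
  \<open>interval\<close> takes the place of closure under subsets, which \<open>partial S i\<close>
  lacks as soon as S has a second colour.\<close>

locale interval_partition =
  fixes D :: nat and \<A> \<F> :: "'x set set" and R :: "'x set \<Rightarrow> 'x set"
  assumes finite_faces: "finite \<A>" and finite_facets: "finite \<F>"
    and facet: "F \<in> \<F> \<Longrightarrow> finite F \<and> card F = D \<and> R F \<subseteq> F"
    and ex1_facet: "\<sigma> \<in> \<A> \<Longrightarrow> \<exists>!F. F \<in> \<F> \<and> R F \<subseteq> \<sigma> \<and> \<sigma> \<subseteq> F"
    and interval: "F \<in> \<F> \<Longrightarrow> R F \<subseteq> \<sigma> \<Longrightarrow> \<sigma> \<subseteq> F \<Longrightarrow> \<sigma> \<in> \<A>"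
begin

lemma facet_unique:
  assumes "\<sigma> \<in> \<A>" "F \<in> \<F>" "R F \<subseteq> \<sigma>" "\<sigma> \<subseteq> F" "F' \<in> \<F>" "R F' \<subseteq> \<sigma>" "\<sigma> \<subseteq> F'"
  shows "F = F'"
  using ex1_facet[OF assms(1)] assms by blast

lemma sum_intervals:
  fixes f :: "'x set \<Rightarrow> 'b::comm_monoid_add"
  shows "(\<Sum>\<sigma> | \<sigma> \<in> \<A> \<and> P \<sigma>. f \<sigma>) =
    (\<Sum>F\<in>\<F>. \<Sum>\<sigma> | \<sigma> \<in> {\<sigma>. R F \<subseteq> \<sigma> \<and> \<sigma> \<subseteq> F} \<and> P \<sigma>. f \<sigma>)"
proof -
  define \<phi> where "\<phi> \<sigma> = (THE F. F \<in> \<F> \<and> R F \<subseteq> \<sigma> \<and> \<sigma> \<subseteq> F)" for \<sigma>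
  have \<phi>: "\<phi> \<sigma> \<in> \<F> \<and> R (\<phi> \<sigma>) \<subseteq> \<sigma> \<and> \<sigma> \<subseteq> \<phi> \<sigma>" if "\<sigma> \<in> \<A>" for \<sigma>
    unfolding \<phi>_def by (rule theI', rule ex1_facet[OF that])
  have "(\<Sum>\<sigma> | \<sigma> \<in> \<A> \<and> P \<sigma>. f \<sigma>) =
      (\<Sum>F\<in>\<F>. \<Sum>\<sigma> | \<sigma> \<in> {\<sigma>. \<sigma> \<in> \<A> \<and> P \<sigma>} \<and> \<phi> \<sigma> = F. f \<sigma>)"
    by (rule sum.group[symmetric]) (use finite_faces finite_facets \<phi> in auto)
  also have "\<dots> = (\<Sum>F\<in>\<F>. \<Sum>\<sigma> | \<sigma> \<in> {\<sigma>. R F \<subseteq> \<sigma> \<and> \<sigma> \<subseteq> F} \<and> P \<sigma>. f \<sigma>)"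
  proof (intro sum.cong refl set_eqI iffI)
    fix F \<sigma> assume "F \<in> \<F>" "\<sigma> \<in> {\<sigma> \<in> {\<sigma>. R F \<subseteq> \<sigma> \<and> \<sigma> \<subseteq> F}. P \<sigma>}"
    moreover from this have "\<sigma> \<in> \<A>" using interval by auto
    ultimately show "\<sigma> \<in> {\<sigma>. \<sigma> \<in> {\<sigma>. \<sigma> \<in> \<A> \<and> P \<sigma>} \<and> \<phi> \<sigma> = F}"
      using ex1_facet[of \<sigma>] \<phi>[of \<sigma>] by auto
  qed (use \<phi> in auto)
  finally show ?thesis .
qed

lemma face_poly_eq: "face_poly D \<A> = (\<Sum>F\<in>\<F>. monom 1 (card (R F)))"
proof -
  have "face_poly D \<A> = (\<Sum>F\<in>\<F>. face_poly (card F) {\<sigma>. R F \<subseteq> \<sigma> \<and> \<sigma> \<subseteq> F})"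
    using sum_intervals[where P="\<lambda>_. True"] facet by (simp add: face_poly_def)
  also have "\<dots> = (\<Sum>F\<in>\<F>. monom 1 (card (R F)))"
    by (intro sum.cong refl face_poly_interval) (use facet in auto)
  finally show ?thesis .
qed

lemma star_poly_eq:
  assumes "\<And>F. F \<in> \<F> \<Longrightarrow> v \<notin> R F \<or> v \<notin> F"
  shows "star_poly D \<A> v = (\<Sum>F | F \<in> \<F> \<and> v \<in> F. monom 1 (card (R F)))"
proof -
  have "star_poly D \<A> v = (\<Sum>F\<in>\<F>. star_poly (card F) {\<sigma>. R F \<subseteq> \<sigma> \<and> \<sigma> \<subseteq> F} v)"
    using sum_intervals[where P="\<lambda>\<sigma>. v \<in> \<sigma>"] facet by (simp add: star_poly_def)
  also have "\<dots> = (\<Sum>F\<in>\<F>. if v \<in> F then monom 1 (card (R F)) else 0)"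
  proof (intro sum.cong refl)
    fix F assume F: "F \<in> \<F>"
    show "star_poly (card F) {\<sigma>. R F \<subseteq> \<sigma> \<and> \<sigma> \<subseteq> F} v =
        (if v \<in> F then monom 1 (card (R F)) else 0)"
    proof (cases "v \<in> F")
      case False
      then have "{\<sigma>. \<sigma> \<in> {\<sigma>. R F \<subseteq> \<sigma> \<and> \<sigma> \<subseteq> F} \<and> v \<in> \<sigma>} = {}" by auto
      with False show ?thesis by (simp only: star_poly_def) simp
    next
      case True
      then show ?thesis
        using F facet[OF F] assms[OF F] star_poly_interval[of F "R F" v] by simp
    qed
  qed
  finally show ?thesis
    by (simp add: sum.inter_filter[symmetric] finite_facets)
qed

lemma coeff_face_poly: "coeff (face_poly D \<A>) K = int (card {F \<in> \<F>. card (R F) = K})"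
  by (simp add: face_poly_eq coeff_sum finite_facets sum.If_cases Int_def conj_commute)

lemma coeff_star_poly:
  assumes "\<And>F. F \<in> \<F> \<Longrightarrow> v \<notin> R F \<or> v \<notin> F"
  shows "coeff (face_poly D \<A>) K - coeff (star_poly D \<A> v) K =
    int (card {F \<in> \<F>. v \<notin> F \<and> card (R F) = K})"
proof -
  have "coeff (star_poly D \<A> v) K = int (card {F \<in> \<F>. v \<in> F \<and> card (R F) = K})"
    by (simp add: star_poly_eq[OF assms] coeff_sum finite_facets sum.If_cases Int_def conj_ac)
  moreover have "card {F \<in> \<F>. card (R F) = K} =
      card {F \<in> \<F>. v \<in> F \<and> card (R F) = K} + card {F \<in> \<F>. v \<notin> F \<and> card (R F) = K}"
    by (subst card_Un_disjoint[symmetric]) (auto simp: finite_facets intro!: arg_cong[of _ _ card])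
  ultimately show ?thesis by (simp add: coeff_face_poly)
qed

end

text \<open>Each \<sigma> is counted once for each of its n vertices. With q = 1 - t and D = n + e,
  the term t^n q^e satisfies q (t^n q^e)' + D t^n q^e = n t^(n-1) q^e (q + t), and q + t =
  1.\<close>

lemma sum_star_poly:
  assumes "finite U" "finite \<A>" "\<And>\<sigma>. \<sigma> \<in> \<A> \<Longrightarrow> \<sigma> \<subseteq> U \<and> card \<sigma> \<le> D"
  shows "(\<Sum>v\<in>U. star_poly D \<A> v) =
    [:1, -1:] * pderiv (face_poly D \<A>) + smult (int D) (face_poly D \<A>)"
proof -
  let ?q = "[:1, -1:] :: int poly"
  have "(\<Sum>v\<in>U. star_poly D \<A> v) =
      (\<Sum>v\<in>U. \<Sum>\<sigma>\<in>\<A>. if v \<in> \<sigma> then monom 1 (card \<sigma> - 1) * ?q ^ (D - card \<sigma>) else 0)"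
    unfolding star_poly_def using assms(2) by (simp only: sum.inter_filter)
  also have "\<dots> = (\<Sum>\<sigma>\<in>\<A>. \<Sum>v\<in>U. if v \<in> \<sigma> then monom 1 (card \<sigma> - 1) * ?q ^ (D - card \<sigma>) else 0)"
    by (rule sum.swap)
  also have "\<dots> = (\<Sum>\<sigma>\<in>\<A>. ?q * pderiv (monom 1 (card \<sigma>) * ?q ^ (D - card \<sigma>)) +
      smult (int D) (monom 1 (card \<sigma>) * ?q ^ (D - card \<sigma>)))"
  proof (intro sum.cong refl)
    fix \<sigma> assume \<sigma>: "\<sigma> \<in> \<A>"
    have U: "{v \<in> U. v \<in> \<sigma>} = \<sigma>" using assms(3)[OF \<sigma>] by auto
    define n e where "n = card \<sigma>" and "e = D - n"
    have D: "D = n + e" using assms(3)[OF \<sigma>] by (simp add: n_def e_def)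
    have pq: "?q * pderiv (?q ^ e) = smult (- int e) (?q ^ e)"
    proof (cases e)
      case (Suc k)
      have "pderiv ?q = [:-1:]" by (simp add: pderiv_pCons)
      then have "?q * pderiv (?q ^ e) = ?q * (smult (int (Suc k)) (?q ^ k) * [:-1:])"
        by (simp only: Suc pderiv_power_Suc)
      also have "\<dots> = smult (- int e) (?q ^ e)" by (simp add: Suc)
      finally show ?thesis .
    qed (simp add: pderiv_1)
    have t: "(?q + monom 1 1) = 1" by (simp add: monom_altdef one_pCons)
    have m: "?q * pderiv (monom 1 n) + smult (int n) (monom 1 n) = smult (int n) (monom 1 (n - 1))"
    proof (cases n)
      case (Suc k)
      have "smult (int n) (monom 1 n) = monom 1 1 * smult (int n) (monom 1 (n - 1))"
        by (simp add: Suc mult_monom smult_monom)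
      moreover have "pderiv (monom 1 n) = smult (int n) (monom 1 (n - 1))"
        by (simp add: pderiv_monom smult_monom)
      ultimately have "?q * pderiv (monom 1 n) + smult (int n) (monom 1 n) =
          (?q + monom 1 1) * smult (int n) (monom 1 (n - 1))" 
        by (simp only: distrib_right)
      then show ?thesis unfolding t by simp
    qed (simp add: pderiv_monom)
    have "?q * pderiv (monom 1 n * ?q ^ e) + smult (int D) (monom 1 n * ?q ^ e) =
        monom 1 n * (?q * pderiv (?q ^ e)) + smult (int e) (monom 1 n * ?q ^ e) +
        ?q ^ e * (?q * pderiv (monom 1 n) + smult (int n) (monom 1 n))"
      unfolding D pderiv_mult by (simp only: of_nat_add smult_add_left algebra_simps mult_smult_left mult_smult_right)
    also have "\<dots> = smult (int n) (monom 1 (n - 1) * ?q ^ e)"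
      unfolding pq m by (simp add: mult.commute)
    finally show "(\<Sum>v\<in>U. if v \<in> \<sigma> then monom 1 (card \<sigma> - 1) * ?q ^ (D - card \<sigma>) else 0) =
        ?q * pderiv (monom 1 (card \<sigma>) * ?q ^ (D - card \<sigma>)) +
        smult (int D) (monom 1 (card \<sigma>) * ?q ^ (D - card \<sigma>))"
      unfolding n_def[symmetric] e_def[symmetric] 
      using assms(1) by (simp only: sum.inter_filter[symmetric] U) (simp add: n_def[symmetric] of_nat_poly)
  qed
  also have "\<dots> = ?q * pderiv (face_poly D \<A>) + smult (int D) (face_poly D \<A>)"
  proof -
    have "smult c (\<Sum>\<sigma>\<in>\<A>. f \<sigma>) = (\<Sum>\<sigma>\<in>\<A>. smult c (f \<sigma>))" for c and f :: "'a set \<Rightarrow> int poly"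
      by (induction \<A> rule: infinite_finite_induct) (auto simp: smult_add_right)
    moreover have "pderiv (\<Sum>\<sigma>\<in>\<A>. f \<sigma>) = (\<Sum>\<sigma>\<in>\<A>. pderiv (f \<sigma>))" for f :: "'a set \<Rightarrow> int poly"
      using higher_pderiv_sum[of 1] by simp
    ultimately show ?thesis
      unfolding face_poly_def by (simp only: sum.distrib sum_distrib_left)
  qed
  finally show ?thesis .
qed

lemma coeff_sum_star_poly:
  assumes "finite U" "finite \<A>" "\<And>\<sigma>. \<sigma> \<in> \<A> \<Longrightarrow> \<sigma> \<subseteq> U \<and> card \<sigma> \<le> D"
  shows "(\<Sum>v\<in>U. coeff (star_poly D \<A> v) K) =
    (int K + 1) * coeff (face_poly D \<A>) (Suc K) + (int D - int K) * coeff (face_poly D \<A>) K"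
proof -
  have "coeff ([:1, -1:] * pderiv (face_poly D \<A>)) K =
      (int K + 1) * coeff (face_poly D \<A>) (Suc K) - int K * coeff (face_poly D \<A>) K"
    by (cases K) (auto simp: coeff_pderiv algebra_simps)
  moreover have "(\<Sum>v\<in>U. coeff (star_poly D \<A> v) K) =
      coeff ([:1, -1:] * pderiv (face_poly D \<A>)) K + int D * coeff (face_poly D \<A>) K"
    using arg_cong[OF sum_star_poly[OF assms], of "\<lambda>p. coeff p K"]
    by (simp only: coeff_sum coeff_add coeff_smult)
  ultimately show ?thesis by (simp only:) (simp add: algebra_simps)
qed

section \<open>Perturbation arguments and dual vectors\<close>

lemma tight_shift:
  fixes f g :: "'x \<Rightarrow> real"
  assumes "finite B" "B \<noteq> {}" "\<And>x. x \<in> B \<Longrightarrow> g x > 0"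
  shows "\<exists>s. (\<forall>x\<in>B. f x + s * g x \<ge> 0) \<and> (\<exists>x\<in>B. f x + s * g x = 0)"
proof -
  \<comment> \<open>Each x demands that s be at least - f x / g x, and the x with the largest demand
    becomes tight. This is the ratio test by which a functional is moved until a new vertex becomes
    tight.\<close>
  define s where "s = Max ((\<lambda>x. - f x / g x) ` B)"
  have "s \<in> (\<lambda>x. - f x / g x) ` B" unfolding s_def using assms by (intro Max_in) auto
  then obtain x where x: "x \<in> B" "s = - f x / g x" by auto
  have "f y + s * g y \<ge> 0" if "y \<in> B" for y
  proof -
    have "- f y / g y \<le> s" unfolding s_def using assms that by (intro Max_ge) auto
    then show ?thesis using assms(3)[OF that] by (simp add: field_simps)
  qed
  moreover have "f x + s * g x = 0" using assms(3)[OF x(1)] by (simp add: x(2))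
  ultimately show ?thesis using x(1) by blast
qed

lemma eventually_affine_pos:
  fixes a b :: real
  assumes "a > 0"
  shows "eventually (\<lambda>t. a + t * b > 0) (at_right 0)"
proof -
  have "((\<lambda>t. a + t * b) \<longlongrightarrow> a + 0 * b) (at_right 0)" by (intro tendsto_intros)
  then show ?thesis using assms by (intro order_tendstoD(1)) auto
qed

lemma eventually_affine_nonzero:
  fixes a b :: real
  assumes "a \<noteq> 0 \<or> b \<noteq> 0"
  shows "eventually (\<lambda>t. a + t * b \<noteq> 0) (at_right 0)"
proof (cases "a = 0")
  case True
  then show ?thesis using assms by (auto simp: eventually_at_right_less eventually_at_filter)
next
  case False
  have "((\<lambda>t. a + t * b) \<longlongrightarrow> a + 0 * b) (at_right 0)" by (intro tendsto_intros)
  then show ?thesis using False by (intro tendsto_imp_eventually_ne) auto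
qed

text \<open>Induction over the hyperplanes: a small multiple of a vector off the new one is added to
  z. Each of the finitely many functionals is affine and not identically zero in the parameter, so
  small positive parameters are good for all.\<close>

lemma avoid_hyperplanes:
  fixes Z W :: "'e::real_inner set"
  assumes "finite Z" "subspace W" "\<And>\<zeta>. \<zeta> \<in> Z \<Longrightarrow> \<exists>x\<in>W. x \<bullet> \<zeta> \<noteq> 0"
  shows "\<exists>z\<in>W. \<forall>\<zeta>\<in>Z. z \<bullet> \<zeta> \<noteq> 0"
  using assms
proof (induction Z rule: finite_induct)
  case empty
  then show ?case using subspace_0 by blast
next
  case (insert \<zeta> Z)
  obtain z where z: "z \<in> W" "\<forall>\<zeta>\<in>Z. z \<bullet> \<zeta> \<noteq> 0" using insert by auto
  obtain x where x: "x \<in> W" "x \<bullet> \<zeta> \<noteq> 0" using insert.prems by auto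
  have "eventually (\<lambda>t. \<forall>\<eta>\<in>insert \<zeta> Z. z \<bullet> \<eta> + t * (x \<bullet> \<eta>) \<noteq> 0) (at_right 0)"
    using insert.hyps x z by (intro eventually_ball_finite ballI eventually_affine_nonzero) auto
  then obtain t where "\<forall>\<eta>\<in>insert \<zeta> Z. z \<bullet> \<eta> + t * (x \<bullet> \<eta>) \<noteq> 0"
    using eventually_happens[of _ "at_right (0::real)"] by (auto simp: trivial_limit_at_right_real)
  then have "\<forall>\<eta>\<in>insert \<zeta> Z. (z + t *\<^sub>R x) \<bullet> \<eta> \<noteq> 0" by (simp add: inner_add_left)
  moreover have "z + t *\<^sub>R x \<in> W" using insert.prems z x by (simp add: subspace_add subspace_scale)
  ultimately show ?case by blast
qed

text \<open>The part of \<open>w\<close> orthogonal to the span of the other vectors is nonzero by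
  independence; it only has to be rescaled.\<close>

lemma independent_dual_vector:
  fixes F :: "'e::euclidean_space set"
  assumes "independent F" "w \<in> F"
  shows "\<exists>u. u \<bullet> w = 1 \<and> (\<forall>x\<in>F - {w}. u \<bullet> x = 0)"
proof -
  obtain s z where sz: "s \<in> span (F - {w})" "\<And>y. y \<in> span (F - {w}) \<Longrightarrow> orthogonal z y" "w = s + z"
    using orthogonal_subspace_decomp_exists[of "F - {w}" w] by metis
  have "w \<notin> span (F - {w})" using assms by (auto simp: dependent_def)
  then have "z \<noteq> 0" using sz by auto
  moreover have "z \<bullet> s = 0" using sz by (auto simp: orthogonal_def)
  ultimately have "((1 / (z \<bullet> z)) *\<^sub>R z) \<bullet> w = 1" by (simp add: sz(3) inner_add_right)
  moreover have "((1 / (z \<bullet> z)) *\<^sub>R z) \<bullet> x = 0" if "x \<in> F - {w}" for x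
    using sz(2)[OF span_base[OF that]] by (auto simp: orthogonal_def)
  ultimately show ?thesis by blast
qed

section \<open>Combinatorial Cayley complexes\<close>

text \<open>A point \<open>y = (-c, b)\<close> of the cone \<open>dual S\<close> records a direction \<open>c\<close> and upper bounds \<open>b j\<close> for
  \<open>c\<close> on \<open>V j\<close>.  The condition \<open>fst y \<noteq> 0\<close> excludes the faces of the Cayley polytope that are
  preimages of faces of the simplex.\<close>

locale cayley_vertices =
  fixes V :: "'m::finite \<Rightarrow> 'a::euclidean_space set"
  assumes finite_V: "finite (V j)"
    and nonconstant: "c \<noteq> 0 \<Longrightarrow> \<exists>v\<in>V j. c \<bullet> v \<noteq> \<beta>"
    and supported: "v \<in> V j \<Longrightarrow> \<exists>c. c \<noteq> 0 \<and> (\<forall>w\<in>V j. c \<bullet> w \<le> c \<bullet> v)"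
    and independent_UNIV:
      "\<forall>j. \<forall>v\<in>V j. (v, axis j (1::real)) \<bullet> y \<ge> 0 \<Longrightarrow> fst y \<noteq> 0 \<Longrightarrow>
       independent {(v, axis j (1::real)) |v j. v \<in> V j \<and> (v, axis j 1) \<bullet> y = 0}"
begin

definition layer :: "'m \<Rightarrow> ('a \<times> (real^'m)) set" where
  "layer j = V j \<times> {axis j 1}"

definition verts :: "'m set \<Rightarrow> ('a \<times> (real^'m)) set" where
  "verts S = (\<Union>j\<in>S. layer j)"

definition dual :: "'m set \<Rightarrow> ('a \<times> (real^'m)) set" where
  "dual S = {y. \<forall>x\<in>verts S. x \<bullet> y \<ge> 0}"

definition zero :: "'m set \<Rightarrow> 'a \<times> (real^'m) \<Rightarrow> ('a \<times> (real^'m)) set" where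
  "zero S y = {x \<in> verts S. x \<bullet> y = 0}"

definition cplx :: "'m set \<Rightarrow> ('a \<times> (real^'m)) set set" where
  "cplx S = {\<sigma>. \<exists>y\<in>dual S. fst y \<noteq> 0 \<and> \<sigma> \<subseteq> zero S y}"

definition facets :: "'m set \<Rightarrow> ('a \<times> (real^'m)) set set" where
  "facets S = {F \<in> cplx S. card F + 1 = DIM('a) + card S}"

text \<open>The space R^d x R^S inside the common ambient space. Functionals are compared on it,
  because their colour coordinates outside S have no effect on \<open>verts S\<close>.\<close>

definition coord :: "'m set \<Rightarrow> ('a \<times> (real^'m)) set" where
  "coord S = {z. \<forall>j. j \<notin> S \<longrightarrow> snd z $ j = 0}"

lemma layer_inner: "x \<in> layer j \<Longrightarrow> x \<bullet> y = fst x \<bullet> fst y + snd y $ j"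
  by (auto simp: layer_def inner_prod_def inner_commute[of "axis j 1"] inner_axis)

lemma layer_disjoint: "x \<in> layer i \<Longrightarrow> x \<in> layer j \<Longrightarrow> i = j"
  by (auto simp: layer_def axis_eq_axis)

lemma finite_layer: "finite (layer j)"
  by (simp add: layer_def finite_V)

lemma finite_verts [simp]: "finite (verts S)"
  by (simp add: verts_def finite_layer)

lemma zero_subset: "zero S y \<subseteq> verts S"
  by (auto simp: zero_def)

lemma finite_zero [simp]: "finite (zero S y)"
  by (rule finite_subset[OF zero_subset]) simp

lemma cplx_subset: "\<sigma> \<in> cplx S \<Longrightarrow> \<sigma> \<subseteq> verts S"
  using zero_subset unfolding cplx_def by blast

lemma cplxI: "y \<in> dual S \<Longrightarrow> fst y \<noteq> 0 \<Longrightarrow> \<sigma> \<subseteq> zero S y \<Longrightarrow> \<sigma> \<in> cplx S"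
  unfolding cplx_def by blast

lemma finite_cplx: "finite (cplx S)"
  by (rule finite_subset[of _ "Pow (verts S)"]) (use cplx_subset in auto)

lemma cplx_down: "\<sigma> \<in> cplx S \<Longrightarrow> \<tau> \<subseteq> \<sigma> \<Longrightarrow> \<tau> \<in> cplx S"
  unfolding cplx_def by blast

lemma layer_nonconstant:
  assumes "fst y \<noteq> 0"
  shows "\<exists>x\<in>layer j. x \<bullet> y \<noteq> 0"
proof -
  obtain v where v: "v \<in> V j" "fst y \<bullet> v \<noteq> - snd y $ j" using nonconstant[OF assms] by blast
  then have "(v, axis j 1) \<in> layer j" by (simp add: layer_def)
  moreover from this have "(v, axis j 1) \<bullet> y \<noteq> 0"
    using v(2) by (simp add: layer_inner inner_commute[of v])
  ultimately show ?thesis by blast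
qed

lemma layer_nonempty: "layer j \<noteq> {}"
proof -
  obtain b :: 'a where "b \<in> Basis" using nonempty_Basis by blast
  then have "b \<noteq> 0" by (rule nonzero_Basis)
  then show ?thesis using nonconstant[of b j 0] by (auto simp: layer_def)
qed

section \<open>Dimension counts and restriction to subfamilies\<close>

lemma coord_subspace: "subspace (coord S)"
  by (auto simp: coord_def subspace_def)

lemma verts_coord: "verts S \<subseteq> coord S"
  by (auto simp: coord_def verts_def layer_def axis_def)

lemma coord_inner_cong:
  assumes "x \<in> coord S" "fst y = fst y'" "\<And>j. j \<in> S \<Longrightarrow> snd y $ j = snd y' $ j"
  shows "x \<bullet> y = x \<bullet> y'"
proof -
  have "snd x \<bullet> snd y = snd x \<bullet> snd y'"
    unfolding inner_vec_def using assms by (intro sum.cong refl) (auto simp: coord_def)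
  then show ?thesis using assms by (simp add: inner_prod_def)
qed

text \<open>The space is the orthogonal complement of the axes outside S together with
  \<open>yS\<close>, which is y with its coordinates outside S erased. The condition
  \<open>fst y \<noteq> 0\<close> keeps \<open>yS\<close> nonzero. The dimension d + |S| - 1 becomes
  the bound on the size of tight sets.\<close>

lemma dim_orth:
  assumes "fst y \<noteq> 0"
  shows "dim {z \<in> coord S. z \<bullet> y = 0} + 1 = DIM('a) + card S"
proof -
  define yS where "yS = (fst y, (\<chi> j. if j \<in> S then snd y $ j else 0))"
  define A where "A = insert yS ((\<lambda>j. (0, axis j 1)) ` (- S))"
  have inj: "inj_on (\<lambda>j. (0::'a, axis j (1::real))) (- S)"
    by (auto simp: inj_on_def axis_eq_axis)
  have notin: "yS \<notin> (\<lambda>j. (0, axis j 1)) ` (- S)" using assms by (auto simp: yS_def)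
  have "card A = card (- S) + 1" unfolding A_def using notin
    by (simp add: card_image[OF inj])
  moreover have "independent A"
  proof (rule pairwise_orthogonal_independent)
    show "pairwise orthogonal A"
      by (auto simp: A_def pairwise_def orthogonal_def inner_prod_def yS_def inner_axis
          inner_axis') (auto simp: axis_def)
    show "0 \<notin> A" using assms by (auto simp: A_def yS_def zero_prod_def axis_eq_0_iff)
  qed
  ultimately have "dim (span A) = card (- S) + 1" by (simp add: dim_eq_card_independent)
  moreover have "dim {z \<in> UNIV. \<forall>x\<in>span A. orthogonal x z} + dim (span A) =
      dim (UNIV :: ('a \<times> (real^'m)) set)"
    by (rule dim_subspace_orthogonal_to_vectors) auto
  moreover have "{z \<in> UNIV. \<forall>x\<in>span A. orthogonal x z} = {z \<in> coord S. z \<bullet> y = 0}"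
  proof (intro set_eqI iffI)
    fix z assume z: "z \<in> {z \<in> UNIV. \<forall>x\<in>span A. orthogonal x z}"
    then have *: "x \<bullet> z = 0" if "x \<in> A" for x
      using that span_base[of x A] by (auto simp: orthogonal_def)
    have "snd z $ j = 0" if "j \<notin> S" for j
      using *[of "(0, axis j 1)"] that by (simp add: A_def inner_prod_def inner_axis')
    then have c: "z \<in> coord S" by (simp add: coord_def)
    have "z \<bullet> y = z \<bullet> yS" by (rule coord_inner_cong[OF c]) (auto simp: yS_def)
    then show "z \<in> {z \<in> coord S. z \<bullet> y = 0}"
      using c *[of yS] by (auto simp: A_def inner_commute)
  next
    fix z assume z: "z \<in> {z \<in> coord S. z \<bullet> y = 0}"
    have "z \<bullet> y = z \<bullet> yS" by (rule coord_inner_cong[of _ S]) (use z in \<open>auto simp: yS_def\<close>)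
    then have "orthogonal z x" if "x \<in> A" for x
      using that z by (auto simp: A_def coord_def orthogonal_def inner_prod_def inner_axis)
    then have "orthogonal z x" if "x \<in> span A" for x
      using that orthogonal_to_span by blast
    then show "z \<in> {z \<in> UNIV. \<forall>x\<in>span A. orthogonal x z}"
      by (auto simp: orthogonal_commute)
  qed
  moreover have "card S + card (- S) = CARD('m)"
    using card_Un_disjoint[of S "- S"] by (simp add: Compl_partition)
  ultimately show ?thesis by simp
qed

text \<open>The bounds for colours outside S can be raised freely, and \<open>b j\<close> is large
  enough. General position concerns the whole family; this lift carries its consequence to
  subfamilies.\<close>

lemma dual_lift:
  assumes "y \<in> dual S"
  shows "\<exists>y'\<in>dual UNIV. fst y' = fst y \<and> (\<forall>j\<in>S. snd y' $ j = snd y $ j)"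
proof -
  define b where "b j = (\<Sum>x\<in>layer j. \<bar>fst x \<bullet> fst y\<bar>)" for j
  define y' where "y' = (fst y, (\<chi> j. if j \<in> S then snd y $ j else b j))"
  have "x \<bullet> y' \<ge> 0" if x: "x \<in> layer j" for x j
  proof (cases "j \<in> S")
    case True
    then have "x \<bullet> y \<ge> 0" using assms x by (auto simp: dual_def verts_def)
    then show ?thesis using x True by (simp add: layer_inner y'_def)
  next
    case False
    have "\<bar>fst x \<bullet> fst y\<bar> \<le> b j" unfolding b_def
      by (rule member_le_sum[OF x]) (auto simp: finite_layer)
    then show ?thesis using x False by (simp add: layer_inner y'_def)
  qed
  then have "y' \<in> dual UNIV" by (auto simp: dual_def verts_def)
  then show ?thesis by (rule bexI[rotated]) (simp add: y'_def)
qed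

lemma independent_zero:
  assumes "y \<in> dual S" "fst y \<noteq> 0"
  shows "independent (zero S y)"
proof -
  obtain y' where y': "y' \<in> dual UNIV" "fst y' = fst y" "\<forall>j\<in>S. snd y' $ j = snd y $ j"
    using dual_lift[OF assms(1)] by blast
  have "zero S y \<subseteq> {(v, axis j (1::real)) |v j. v \<in> V j \<and> (v, axis j 1) \<bullet> y' = 0}"
  proof
    fix x assume "x \<in> zero S y"
    then obtain j where j: "j \<in> S" "x \<in> layer j" "x \<bullet> y = 0" by (auto simp: zero_def verts_def)
    then have "x \<bullet> y' = 0" using y' by (simp add: layer_inner)
    then show "x \<in> {(v, axis j (1::real)) |v j. v \<in> V j \<and> (v, axis j 1) \<bullet> y' = 0}"
      using j by (auto simp: layer_def)
  qed
  moreover have "independent {(v, axis j (1::real)) |v j. v \<in> V j \<and> (v, axis j 1) \<bullet> y' = 0}"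
  proof (rule independent_UNIV)
    show "\<forall>j. \<forall>v\<in>V j. (v, axis j 1) \<bullet> y' \<ge> 0"
      using y'(1) by (auto simp: dual_def verts_def layer_def)
    show "fst y' \<noteq> 0" using y'(2) assms(2) by simp
  qed
  ultimately show ?thesis by (rule independent_mono[rotated])
qed

lemma independent_cplx:
  assumes "\<sigma> \<in> cplx S"
  shows "independent \<sigma>"
proof -
  obtain y where y: "y \<in> dual S" "fst y \<noteq> 0" "\<sigma> \<subseteq> zero S y"
    using assms by (auto simp: cplx_def)
  from independent_zero[OF y(1,2)] y(3) show ?thesis by (rule independent_mono)
qed

text \<open>Bounds for the additional colours are supplied by \<open>dual_lift\<close>, and
  forgetting them leads back. So the complexes of subfamilies are induced subcomplexes, and deleting
  a colour amounts to avoiding its layer.\<close>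

lemma cplx_eq:
  "\<sigma> \<in> cplx S \<longleftrightarrow> \<sigma> \<in> cplx UNIV \<and> \<sigma> \<subseteq> verts S"
proof
  assume \<sigma>: "\<sigma> \<in> cplx S"
  then obtain y where y: "y \<in> dual S" "fst y \<noteq> 0" "\<sigma> \<subseteq> zero S y" by (auto simp: cplx_def)
  obtain y' where y': "y' \<in> dual UNIV" "fst y' = fst y" "\<forall>j\<in>S. snd y' $ j = snd y $ j"
    using dual_lift[OF y(1)] by blast
  have "\<sigma> \<subseteq> zero UNIV y'"
    using y(3) y'(2,3) by (force simp: zero_def verts_def layer_inner)
  then show "\<sigma> \<in> cplx UNIV \<and> \<sigma> \<subseteq> verts S"
    using y y' cplx_subset[OF \<sigma>] cplxI[of y' UNIV] by auto
next
  assume \<sigma>: "\<sigma> \<in> cplx UNIV \<and> \<sigma> \<subseteq> verts S"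
  then obtain y where y: "y \<in> dual UNIV" "fst y \<noteq> 0" "\<sigma> \<subseteq> zero UNIV y" by (auto simp: cplx_def)
  have "y \<in> dual S" using y by (auto simp: dual_def verts_def)
  then show "\<sigma> \<in> cplx S" using y \<sigma> by (intro cplxI[of y]) (auto simp: zero_def)
qed

text \<open>A supporting direction c at v gives a functional for colour i alone, with bound
  \<open>c \<bullet> v\<close>; \<open>cplx_eq\<close> then passes from {i} to UNIV and back to
  S.\<close>

lemma vertex_in_cplx:
  assumes "x \<in> verts S"
  shows "{x} \<in> cplx S"
proof -
  obtain i v where i: "i \<in> S" "v \<in> V i" "x = (v, axis i 1)" using assms by (auto simp: verts_def layer_def)
  obtain c where c: "c \<noteq> 0" "\<forall>w\<in>V i. c \<bullet> w \<le> c \<bullet> v" using supported[OF i(2)] by blast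
  define y where "y = (- c, (\<chi> j. if j = i then c \<bullet> v else 0) :: real^'m)"
  have "y \<in> dual {i}"
    using c by (auto simp: dual_def verts_def layer_inner y_def) (auto simp: layer_def inner_commute)
  moreover have "{x} \<subseteq> zero {i} y"
    using i by (auto simp: zero_def verts_def layer_def y_def inner_prod_def inner_commute[of "axis _ _"] inner_axis inner_commute[of c])
  ultimately have "{x} \<in> cplx {i}" using c by (intro cplxI[of y]) (auto simp: y_def)
  then show ?thesis using cplx_eq[of "{x}" "{i}"] cplx_eq[of "{x}" S] assms by blast
qed

lemma empty_in_cplx: "{} \<in> cplx S"
proof -
  obtain x where "x \<in> layer undefined" using layer_nonempty by blast
  then have "{x} \<in> cplx UNIV" by (intro vertex_in_cplx) (auto simp: verts_def)
  then have "{} \<in> cplx UNIV" by (rule cplx_down) simp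
  then show ?thesis using cplx_eq[of "{}" S] by blast
qed

lemma zero_subset_orth: "zero S y \<subseteq> {z \<in> coord S. z \<bullet> y = 0}"
  using verts_coord by (auto simp: zero_def)

lemma card_zero:
  assumes "y \<in> dual S" "fst y \<noteq> 0"
  shows "card (zero S y) + 1 \<le> DIM('a) + card S"
  using independent_card_le_dim[OF zero_subset_orth independent_zero[OF assms]] dim_orth[OF assms(2), of S]
  by simp

lemma span_zero:
  assumes "y \<in> dual S" "fst y \<noteq> 0" "card (zero S y) + 1 = DIM('a) + card S"
    and "z \<in> coord S" "z \<bullet> y = 0"
  shows "z \<in> span (zero S y)"
  using card_ge_dim_independent[OF zero_subset_orth independent_zero[OF assms(1,2)]]
    dim_orth[OF assms(2), of S] assms(3-5) by auto

text \<open>Lowering the bound of colour j by its slack \<mu> makes a vertex of that layer tight and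
  changes no value on the other layers. Hence a maximal tight set uses every colour of S.\<close>

lemma zero_all_layers:
  assumes "y \<in> dual S" "fst y \<noteq> 0" "j \<in> S" "zero S y \<inter> layer j = {}"
  shows "\<exists>y'\<in>dual S. fst y' \<noteq> 0 \<and> zero S y \<subset> zero S y'"
proof -
  define \<mu> where "\<mu> = Min ((\<lambda>x. x \<bullet> y) ` layer j)"
  define y' where "y' = y - (0, axis j \<mu>)"
  have "\<mu> \<in> (\<lambda>x. x \<bullet> y) ` layer j" unfolding \<mu>_def
    using layer_nonempty finite_layer by (intro Min_in) auto
  then obtain x where x: "x \<in> layer j" "x \<bullet> y = \<mu>" by auto
  have in': "z \<bullet> y' = z \<bullet> y - (if k = j then \<mu> else 0)" if "z \<in> layer k" for z k
    using that by (simp add: layer_inner y'_def axis_def)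
  have "z \<bullet> y' \<ge> 0" if "k \<in> S" "z \<in> layer k" for z k
  proof -
    have "z \<bullet> y \<ge> 0" using that assms by (auto simp: dual_def verts_def)
    moreover have "\<mu> \<le> z \<bullet> y" if "k = j"
      unfolding \<mu>_def using \<open>z \<in> layer k\<close> that finite_layer by (intro Min_le) auto
    ultimately show ?thesis using in'[OF that(2)] by auto
  qed
  then have "y' \<in> dual S" by (auto simp: dual_def verts_def)
  moreover have "zero S y \<subseteq> zero S y'"
    using assms(4) in' by (fastforce simp: zero_def verts_def)
  moreover have "x \<in> zero S y'" using x in'[OF x(1)] assms(3) by (auto simp: zero_def verts_def)
  moreover have "x \<notin> zero S y" using x assms(4) by auto
  ultimately show ?thesis using assms(2) by (intro bexI[of _ y']) (auto simp: y'_def)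
qed

text \<open>A largest tight set above the given one is taken. If it had fewer than d + |S| - 1
  vertices, there would be a direction z in \<open>coord S\<close> orthogonal to it and to
  \<open>y'\<close>, and shifting \<open>y'\<close> along z or - z up to a new tight vertex would
  enlarge it. The delicate point is that the first component must not become zero.\<close>

lemma zero_in_facet:
  assumes "y \<in> dual S" "fst y \<noteq> 0" "S \<noteq> {}"
  shows "\<exists>y'\<in>dual S. fst y' \<noteq> 0 \<and> zero S y \<subseteq> zero S y' \<and> card (zero S y') + 1 = DIM('a) + card S"
proof -
  define Y where "Y = {y' \<in> dual S. fst y' \<noteq> 0 \<and> zero S y \<subseteq> zero S y'}"
  have "y \<in> Y" using assms by (simp add: Y_def)
  moreover have "\<forall>y'. y' \<in> Y \<longrightarrow> card (zero S y') < DIM('a) + card S"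
    using card_zero unfolding Y_def by force
  ultimately obtain y' where y': "y' \<in> Y" "\<forall>z. z \<in> Y \<longrightarrow> card (zero S z) \<le> card (zero S y')"
    using ex_has_greatest_nat[of "\<lambda>y. y \<in> Y" y "\<lambda>y. card (zero S y)" "DIM('a) + card S"] by blast
  have max: "\<not> zero S y' \<subset> zero S z" if "z \<in> dual S" "fst z \<noteq> 0" for z
  proof
    assume less: "zero S y' \<subset> zero S z"
    then have "z \<in> Y" using y'(1) that by (auto simp: Y_def)
    then show False using y'(2) psubset_card_mono[OF finite_zero less] by fastforce
  qed
  have d: "y' \<in> dual S" "fst y' \<noteq> 0" using y' by (auto simp: Y_def)
  have hit: "zero S y' \<inter> layer j \<noteq> {}" if "j \<in> S" for j
    using zero_all_layers[OF d that] max by blast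
  have "card (zero S y') + 1 = DIM('a) + card S"
  proof (rule ccontr)
    assume "card (zero S y') + 1 \<noteq> DIM('a) + card S"
    then have lt: "card (zero S y') + 1 < DIM('a) + card S" using card_zero[OF d] by simp
    define H where "H = {z \<in> coord S. z \<bullet> y' = 0}"
    have "subspace H" unfolding H_def coord_def by (auto simp: subspace_def inner_left_distrib)
    have "dim (span (zero S y')) < dim H"
      using lt dim_orth[OF d(2), of S] independent_zero[OF d]
      by (simp add: H_def dim_eq_card_independent)
    moreover have "span (zero S y') \<subseteq> H"
      using zero_subset_orth \<open>subspace H\<close> unfolding H_def by (intro span_minimal)
    ultimately have "span (zero S y') \<subset> span H"
      using \<open>subspace H\<close> by (metis order_less_irrefl psubsetI span_eq_iff)
    then obtain z where z: "z \<noteq> 0" "z \<in> span H" "\<And>x. x \<in> span (zero S y') \<Longrightarrow> orthogonal z x"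
      using orthogonal_to_subspace_exists_gen by metis
    have zH: "z \<in> coord S" "z \<bullet> y' = 0" 
    proof -
      have "z \<in> H" using z(2) \<open>subspace H\<close> by (metis span_eq_iff)
      then show "z \<in> coord S" "z \<bullet> y' = 0" by (auto simp: H_def)
    qed
    have z0: "x \<bullet> z = 0" if "x \<in> zero S y'" for x
      using z(3)[OF span_base[OF that]] by (simp add: orthogonal_def inner_commute)
    \<comment> \<open>A functional with zero first component that vanishes on a set meeting all
      layers of S has zero colour coordinates in S. For \<open>z\<close> this gives z = 0. For
      \<open>y' + t *\<^sub>R z\<close> it gives zero values on \<open>coord S\<close>, and pairing
      with z, which is orthogonal to \<open>y'\<close>, yields t = 0.\<close>
    have fz: "fst y' + t *\<^sub>R fst z \<noteq> 0 \<and> fst z \<noteq> 0" for t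
    proof (rule ccontr)
      assume neg: "\<not> (fst y' + t *\<^sub>R fst z \<noteq> 0 \<and> fst z \<noteq> 0)"
      have zero_comp: "snd q $ j = 0" if "j \<in> S" "fst q = 0" "\<forall>x\<in>zero S y'. x \<bullet> q = 0" for q j
      proof -
        obtain x where "x \<in> zero S y'" "x \<in> layer j" using hit[OF \<open>j \<in> S\<close>] by blast
        then show ?thesis using that layer_inner[of x j q] by auto
      qed
      show False
      proof (cases "fst z = 0")
        case True
        then have "snd z $ j = 0" for j
          using zH(1) zero_comp[of j z] z0 by (cases "j \<in> S") (auto simp: coord_def)
        then have "z = 0" using True by (simp add: prod_eq_iff vec_eq_iff)
        then show False using z(1) by simp
      next
        case False
        then have f0: "fst (y' + t *\<^sub>R z) = 0" using neg by simp
        have "z \<bullet> (y' + t *\<^sub>R z) = z \<bullet> 0"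
          using zH(1)
        proof (rule coord_inner_cong)
          show "fst (y' + t *\<^sub>R z) = fst 0" using f0 by simp
          fix j assume "j \<in> S"
          then show "snd (y' + t *\<^sub>R z) $ j = snd 0 $ j"
            using zero_comp[OF _ f0] z0 by (simp add: inner_add_right zero_def)
        qed
        then have "t * (z \<bullet> z) = 0" using zH(2) by (simp add: inner_add_right)
        then have "t = 0" using z(1) by simp
        then show False using f0 d(2) by simp
      qed
    qed
    have "\<exists>q. fst q \<noteq> 0 \<and> (\<forall>t. fst y' + t *\<^sub>R fst q \<noteq> 0) \<and> (\<forall>x\<in>zero S y'. x \<bullet> q = 0) \<and>
        (\<exists>x\<in>verts S. x \<bullet> q > 0)"
    proof -
      obtain j where "j \<in> S" using assms(3) by blast
      then obtain x where x: "x \<in> verts S" "x \<bullet> z \<noteq> 0"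
        using layer_nonconstant[of z j] fz by (auto simp: verts_def)
      show ?thesis
      proof (cases "x \<bullet> z > 0")
        case True
        then show ?thesis using fz z0 x by (intro exI[of _ z]) auto
      next
        case False
        have "fst y' + t *\<^sub>R fst (- z) \<noteq> 0" for t using fz[of "- t"] by simp
        moreover have "x \<bullet> - z > 0" using False x by simp
        ultimately show ?thesis using fz z0 x(1) by (intro exI[of _ "- z"] conjI bexI[of _ x]) auto
      qed
    qed
    then obtain q where q': "fst q \<noteq> 0 \<and> (\<forall>t. fst y' + t *\<^sub>R fst q \<noteq> 0) \<and>
        (\<forall>x\<in>zero S y'. x \<bullet> q = 0) \<and> (\<exists>x\<in>verts S. x \<bullet> q > 0)" ..
    then have q: "\<And>t. fst y' + t *\<^sub>R fst q \<noteq> 0" "\<And>x. x \<in> zero S y' \<Longrightarrow> x \<bullet> q = 0"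
      "\<exists>x\<in>verts S. x \<bullet> q > 0" by simp_all
    \<comment> \<open>With s \<le> 0 only vertices of positive \<open>q\<close>-value lose, so these
      alone can obstruct the shift.\<close>
    define B where "B = {x \<in> verts S. x \<bullet> q > 0}"
    have "\<exists>s. (\<forall>x\<in>B. x \<bullet> y' + s * (x \<bullet> q) \<ge> 0) \<and> (\<exists>x\<in>B. x \<bullet> y' + s * (x \<bullet> q) = 0)"
      by (rule tight_shift) (use q(3) in \<open>auto simp: B_def\<close>)
    then obtain s where s: "(\<forall>x\<in>B. x \<bullet> y' + s * (x \<bullet> q) \<ge> 0) \<and> (\<exists>x\<in>B. x \<bullet> y' + s * (x \<bullet> q) = 0)" ..
    then obtain x0 where x0: "x0 \<in> B" "x0 \<bullet> y' + s * (x0 \<bullet> q) = 0" by blast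
    have y0: "x \<bullet> y' \<ge> 0" if "x \<in> verts S" for x using d that by (auto simp: dual_def)
    have "s * (x0 \<bullet> q) \<le> 0" using x0 y0[of x0] by (auto simp: B_def)
    then have "s \<le> 0" using x0 by (auto simp: B_def mult_le_0_iff)
    have "x \<bullet> y' + s * (x \<bullet> q) \<ge> 0" if "x \<in> verts S" for x
    proof (cases "x \<in> B")
      case False
      then have "s * (x \<bullet> q) \<ge> 0" using \<open>s \<le> 0\<close> that by (auto simp: B_def zero_le_mult_iff)
      then show ?thesis using y0[OF that] by simp
    qed (use s in auto)
    then have "y' + s *\<^sub>R q \<in> dual S" by (auto simp: dual_def inner_add_right)
    moreover have "fst (y' + s *\<^sub>R q) \<noteq> 0" using q(1) by simp
    moreover have "zero S y' \<subseteq> zero S (y' + s *\<^sub>R q)"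
      using q(2) by (auto simp: zero_def inner_add_right)
    moreover have "x0 \<in> zero S (y' + s *\<^sub>R q)" using x0 by (auto simp: zero_def B_def inner_add_right)
    moreover have "x0 \<notin> zero S y'" using x0 q(2)[of x0] by (auto simp: B_def)
    ultimately show False using max[of "y' + s *\<^sub>R q"] by blast
  qed
  moreover have "zero S y \<subseteq> zero S y'" using y'(1) by (simp add: Y_def)
  ultimately show ?thesis using d by (intro bexI[of _ y'] conjI)
qed

subsection \<open>Facets and generic lines\<close>

text \<open>For nonempty S the choice is unique on \<open>coord S\<close> up to a positive factor,
  see \<open>dual_proportional\<close>, so the quotients formed with it below do not depend on the
  choice.\<close>

definition normal :: "'m set \<Rightarrow> ('a \<times> (real^'m)) set \<Rightarrow> 'a \<times> (real^'m)" where
  "normal S F = (SOME y. y \<in> dual S \<and> fst y \<noteq> 0 \<and> zero S y = F)"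

text \<open>For x in the span of F, \<open>x \<bullet> dual_basis F w\<close> is the coefficient of
  w in x; values off this span are arbitrary.\<close>

definition dual_basis :: "('a \<times> (real^'m)) set \<Rightarrow> 'a \<times> (real^'m) \<Rightarrow> 'a \<times> (real^'m)" where
  "dual_basis F w = (SOME u. u \<bullet> w = 1 \<and> (\<forall>x\<in>F - {w}. u \<bullet> x = 0))"

text \<open>The unnormalized barycentre of a layer: a vector at which every functional of the cone
  with nonzero first component is strictly positive.\<close>

definition centre :: "'m \<Rightarrow> 'a \<times> (real^'m)" where
  "centre j = (\<Sum>x\<in>layer j. x)"

lemma facetsD: "F \<in> facets S \<Longrightarrow> F \<in> cplx S \<and> F \<subseteq> verts S \<and> finite F \<and> card F + 1 = DIM('a) + card S"
  using cplx_subset finite_subset[OF cplx_subset finite_verts] by (auto simp: facets_def)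

lemma finite_facets: "finite (facets S)"
  using finite_cplx by (auto simp: facets_def)

lemma normal:
  assumes "F \<in> facets S"
  shows "normal S F \<in> dual S" "fst (normal S F) \<noteq> 0" "zero S (normal S F) = F"
proof -
  obtain y where y: "y \<in> dual S" "fst y \<noteq> 0" "F \<subseteq> zero S y"
    using assms by (auto simp: facets_def cplx_def)
  moreover have "F = zero S y"
    using card_zero[OF y(1,2)] facetsD[OF assms] y(3) by (intro card_seteq) auto
  ultimately have "\<exists>y. y \<in> dual S \<and> fst y \<noteq> 0 \<and> zero S y = F" by (intro exI[of _ y]) simp
  from someI_ex[OF this] show "normal S F \<in> dual S" "fst (normal S F) \<noteq> 0" "zero S (normal S F) = F"
    by (simp_all add: normal_def)
qed

lemma zero_facet:
  assumes "y \<in> dual S" "fst y \<noteq> 0" "card (zero S y) + 1 = DIM('a) + card S"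
  shows "zero S y \<in> facets S"
  using assms cplxI[of y S "zero S y"] by (simp add: facets_def)

lemma in_facet:
  assumes "\<sigma> \<in> cplx S" "S \<noteq> {}"
  shows "\<exists>F\<in>facets S. \<sigma> \<subseteq> F"
proof -
  obtain y where y: "y \<in> dual S" "fst y \<noteq> 0" "\<sigma> \<subseteq> zero S y" using assms by (auto simp: cplx_def)
  obtain y' where y': "y' \<in> dual S" "fst y' \<noteq> 0" "zero S y \<subseteq> zero S y'"
    "card (zero S y') + 1 = DIM('a) + card S"
    using zero_in_facet[OF y(1,2) assms(2)] by auto
  show ?thesis using zero_facet[OF y'(1,2,4)] y(3) y'(3) by blast
qed

lemma dual_basis:
  assumes "F \<in> facets S" "w \<in> F"
  shows "dual_basis F w \<bullet> w = 1" "x \<in> F \<Longrightarrow> x \<noteq> w \<Longrightarrow> dual_basis F w \<bullet> x = 0"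
proof -
  have "independent F" using independent_cplx facetsD[OF assms(1)] by blast
  from someI_ex[OF independent_dual_vector[OF this assms(2)]]
  show "dual_basis F w \<bullet> w = 1" "x \<in> F \<Longrightarrow> x \<noteq> w \<Longrightarrow> dual_basis F w \<bullet> x = 0"
    by (simp_all add: dual_basis_def)
qed

lemma facet_layer:
  assumes "F \<in> facets S" "j \<in> S"
  shows "F \<inter> layer j \<noteq> {}"
proof
  assume "F \<inter> layer j = {}"
  then obtain y where y: "y \<in> dual S" "fst y \<noteq> 0" "F \<subset> zero S y"
    using zero_all_layers[OF normal(1,2)[OF assms(1)] assms(2)] normal(3)[OF assms(1)] by auto
  then have "card F < card (zero S y)" by (intro psubset_card_mono) auto
  then show False using card_zero[OF y(1,2)] facetsD[OF assms(1)] by simp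
qed

lemma facet_expansion:
  assumes F: "F \<in> facets S" and "\<psi> \<in> coord S" "\<psi> \<bullet> normal S F = 0"
  shows "\<psi> = (\<Sum>w\<in>F. (\<psi> \<bullet> dual_basis F w) *\<^sub>R w)"
proof -
  have fin: "finite F" using facetsD[OF F] by simp
  have "\<psi> \<in> span F"
    using span_zero[OF normal(1,2)[OF F]] normal(3)[OF F] facetsD[OF F] assms(2,3) by simp
  then obtain a where a: "\<psi> = (\<Sum>w\<in>F. a w *\<^sub>R w)" using span_finite[OF fin] by auto
  have "\<psi> \<bullet> dual_basis F w = a w" if w: "w \<in> F" for w
  proof -
    have "\<psi> \<bullet> dual_basis F w = (\<Sum>x\<in>F. a x * (x \<bullet> dual_basis F w))"
      by (simp add: a inner_sum_left)
    also have "\<dots> = (\<Sum>x\<in>F. if x = w then a w else 0)"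
      using dual_basis[OF F w] by (intro sum.cong refl) (auto simp: inner_commute)
    finally show ?thesis using w fin by simp
  qed
  then show ?thesis using a by simp
qed

lemma centre_pos:
  assumes "y \<in> dual S" "fst y \<noteq> 0" "j \<in> S"
  shows "centre j \<bullet> y > 0"
proof -
  obtain x where x: "x \<in> layer j" "x \<bullet> y \<noteq> 0" using layer_nonconstant[OF assms(2)] by blast
  have "z \<bullet> y \<ge> 0" if "z \<in> layer j" for z
    using that assms(1,3) by (auto simp: dual_def verts_def)
  then have "(\<Sum>z\<in>layer j. z \<bullet> y) > 0"
    using x by (intro sum_pos2[OF finite_layer x(1)]) (auto simp: less_le)
  then show ?thesis by (simp add: centre_def inner_sum_left)
qed

lemma centre_coord: "j \<in> S \<Longrightarrow> centre j \<in> coord S"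
  unfolding centre_def
  by (intro subspace_sum coord_subspace) (use verts_coord in \<open>auto simp: verts_def\<close>)

lemma snd_layer: "x \<in> layer j \<Longrightarrow> snd x $ k = (if k = j then 1 else 0)"
  by (auto simp: layer_def axis_def)

lemma snd_centre: "snd (centre j) $ k = (if k = j then real (card (layer j)) else 0)"
  by (simp add: centre_def snd_sum snd_layer)

lemma card_layer_pos: "card (layer j) > 0"
  using layer_nonempty finite_layer by (simp add: card_gt_0_iff)

text \<open>Both functionals vanish on the hyperplane of \<open>coord S\<close> spanned by the
  facet, so they differ by a factor, which is positive because both are positive at
  \<open>centre j\<close>.\<close>

lemma dual_proportional:
  assumes "j \<in> S" "y \<in> dual S" "fst y \<noteq> 0" "y' \<in> dual S" "fst y' \<noteq> 0"
    "zero S y = zero S y'" "zero S y \<in> facets S"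
  shows "\<exists>l>0. \<forall>\<xi>\<in>coord S. \<xi> \<bullet> y' = l * (\<xi> \<bullet> y)"
proof -
  let ?q = "centre j"
  have q: "?q \<bullet> y > 0" "?q \<bullet> y' > 0" using assms centre_pos by auto
  have "\<xi> \<bullet> y' = (?q \<bullet> y' / (?q \<bullet> y)) * (\<xi> \<bullet> y)" if \<xi>: "\<xi> \<in> coord S" for \<xi>
  proof -
    define \<eta> where "\<eta> = \<xi> - ((\<xi> \<bullet> y) / (?q \<bullet> y)) *\<^sub>R ?q"
    have "\<eta> \<in> coord S" unfolding \<eta>_def
      using \<xi> centre_coord[OF assms(1)] coord_subspace by (simp add: subspace_diff subspace_scale)
    moreover have "\<eta> \<bullet> y = 0" using q by (simp add: \<eta>_def inner_diff_left)
    ultimately have "\<eta> \<in> span (zero S y)"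
      using span_zero[OF assms(2,3)] facetsD[OF assms(7)] by simp
    then have "orthogonal y' \<eta>"
    proof (rule orthogonal_to_span)
      fix x assume "x \<in> zero S y"
      then show "orthogonal y' x"
        unfolding assms(6) by (simp add: zero_def orthogonal_def inner_commute)
    qed
    then have "\<eta> \<bullet> y' = 0" by (simp add: orthogonal_def inner_commute)
    then show ?thesis using q by (simp add: \<eta>_def inner_diff_left)
  qed
  moreover have "?q \<bullet> y' / (?q \<bullet> y) > 0" using q by simp
  ultimately show ?thesis by blast
qed

text \<open>The line through \<open>p\<close>, a point of the Cayley polytope near its vertex \<open>v\<close>, in direction \<open>n\<close>
  meets the hyperplane of each facet in general position.\<close>

lemma generic_line:
  assumes i: "i \<in> S" and v: "v \<in> layer i"
  shows "\<exists>n p. n \<in> coord S \<and> p \<in> coord S \<and>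
    (\<forall>j\<in>S. snd n $ j > 0) \<and> (\<forall>j\<in>S - {i}. snd p $ j = 0) \<and>
    (\<forall>F\<in>facets S. n \<bullet> normal S F > 0 \<and> p \<bullet> normal S F > 0) \<and>
    (\<forall>F\<in>facets S. \<forall>w\<in>F.
      (p - ((p \<bullet> normal S F) / (n \<bullet> normal S F)) *\<^sub>R n) \<bullet> dual_basis F w \<noteq> 0) \<and>
    (\<forall>F\<in>facets S. v \<in> F \<longrightarrow>
      (p - ((p \<bullet> normal S F) / (n \<bullet> normal S F)) *\<^sub>R n) \<bullet> dual_basis F v > 0) \<and>
    (\<forall>F\<in>facets S. S \<noteq> {i} \<or> v \<in> F \<longrightarrow>
      snd p $ i * (n \<bullet> normal S F) > snd n $ i * (p \<bullet> normal S F))"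
proof -
  let ?q = "centre i" and ?N = "real (card (layer i))" 
  let ?o = "\<Sum>j\<in>S - {i}. centre j"
  \<comment> \<open>The facets at which the colour-i coordinate of the meeting point is to be
    positive. For S = {i} there are no other colours to give room for this, and it is arranged at
    the facets through v, where \<open>v \<bullet> normal S F = 0\<close>.\<close>
  define G where "G = {F \<in> facets S. S \<noteq> {i} \<or> v \<in> F}"
  have G: "finite G" "\<And>F. F \<in> G \<Longrightarrow> F \<in> facets S" using finite_facets by (auto simp: G_def)
  have ev: "\<exists>t>0. P t" if "eventually P (at_right (0::real))" for P
  proof -
    have "eventually (\<lambda>t. t > 0 \<and> P t) (at_right (0::real))"
      using that by (auto simp: eventually_at_right_less intro: eventually_conj)
    from eventually_happens[OF this] show ?thesis by (simp add: trivial_limit_at_right_real)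
  qed
  have vS: "v \<in> verts S" using i v by (auto simp: verts_def)
  then have vc: "v \<in> coord S" using verts_coord by blast
  have qc: "?q \<in> coord S" using centre_coord[OF i] .
  have oc: "?o \<in> coord S" by (intro subspace_sum coord_subspace) (auto intro: centre_coord)
  have q: "?q \<bullet> normal S F > 0" if "F \<in> facets S" for F
    using centre_pos[OF normal(1,2)[OF that] i] .
  have vn: "v \<bullet> normal S F \<ge> 0" if "F \<in> facets S" for F
    using normal(1)[OF that] vS by (auto simp: dual_def)
  have vF: "v \<bullet> normal S F = 0" if "F \<in> facets S" "v \<in> F" for F
    using normal(3)[OF that(1)] that(2) by (auto simp: zero_def)
  have o: "?o \<bullet> normal S F > 0" if "F \<in> facets S" "S \<noteq> {i}" for F
  proof -
    have "S - {i} \<noteq> {}" using that i by blast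
    then show ?thesis using centre_pos[OF normal(1,2)[OF that(1)]]
      unfolding inner_sum_left by (intro sum_pos) auto
  qed
  have o': "?o \<bullet> normal S F \<ge> 0" if "F \<in> facets S" for F
    using centre_pos[OF normal(1,2)[OF that]]
    unfolding inner_sum_left by (intro sum_nonneg) (auto intro: less_imp_le)
  \<comment> \<open>For small \<kappa> colour i has little weight in the direction, and the other
    colours, which are positive on every normal, outweigh the term with v.\<close>
  have "eventually (\<lambda>\<kappa>. \<forall>F\<in>facets S. S \<noteq> {i} \<longrightarrow>
      ?o \<bullet> normal S F + \<kappa> * (?q \<bullet> normal S F - ?N * (v \<bullet> normal S F)) > 0) (at_right 0)"
    using o by (intro eventually_ball_finite finite_facets ballI) (auto intro!: eventually_affine_pos)
  from ev[OF this] obtain \<kappa> where \<kappa>: "\<kappa> > 0" "\<And>F. F \<in> facets S \<Longrightarrow> S \<noteq> {i} \<Longrightarrow>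
      ?o \<bullet> normal S F + \<kappa> * (?q \<bullet> normal S F - ?N * (v \<bullet> normal S F)) > 0" by blast
  define n0 where "n0 = \<kappa> *\<^sub>R ?q + ?o"
  have n0c: "n0 \<in> coord S"
    unfolding n0_def using qc oc coord_subspace by (simp add: subspace_add subspace_scale)
  have snd_n0: "snd n0 $ j = (if j = i then \<kappa> * ?N else real (card (layer j)))" if "j \<in> S" for j
  proof -
    have "snd ?o $ j = (\<Sum>k\<in>S - {i}. if k = j then real (card (layer j)) else 0)"
      unfolding snd_sum sum_component by (intro sum.cong refl) (auto simp: snd_centre)
    then show ?thesis using that by (simp add: n0_def snd_centre)
  qed
  have n0p: "snd n0 $ j > 0" if "j \<in> S" for j
    using snd_n0[OF that] \<kappa> card_layer_pos by auto
  have n0n: "n0 \<bullet> normal S F > 0" if "F \<in> facets S" for F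
    using q[OF that] o'[OF that] \<kappa>(1) by (simp add: n0_def inner_add_left add_pos_nonneg)
  have n0g: "n0 \<bullet> normal S F - snd n0 $ i * (v \<bullet> normal S F) > 0"
    if "F \<in> G" for F
  proof (cases "v \<in> F")
    case True
    then show ?thesis using n0n[OF G(2)[OF that]] vF[OF G(2)[OF that]] by simp
  next
    case False
    then have "S \<noteq> {i}" using that by (simp add: G_def)
    then show ?thesis using \<kappa>(2)[OF G(2)[OF that]] snd_n0[OF i]
      by (simp add: n0_def inner_add_left algebra_simps)
  qed
  \<comment> \<open>\<open>n \<bullet> \<zeta> F w\<close> is \<open>n \<bullet> normal S F\<close>
    times the coefficient of w at the point where the line through \<open>?q\<close> in direction n
    meets the hyperplane of F. Moving n off the hyperplanes of \<open>Z\<close> makes all these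
    coefficients nonzero.\<close>
  define \<zeta> where "\<zeta> F w = (?q \<bullet> dual_basis F w) *\<^sub>R normal S F - (?q \<bullet> normal S F) *\<^sub>R dual_basis F w" for F w
  define Z where "Z = (\<Union>F\<in>facets S. \<zeta> F ` F)"
  have "finite Z" unfolding Z_def using finite_facets facetsD by auto
  moreover have "\<exists>x\<in>coord S. x \<bullet> \<eta> \<noteq> 0" if \<eta>: "\<eta> \<in> Z" for \<eta>
  proof -
    obtain F w where F: "F \<in> facets S" "w \<in> F" "\<eta> = \<zeta> F w" using \<eta> unfolding Z_def by blast
    have "w \<bullet> normal S F = 0" using normal(3)[OF F(1)] F(2) by (auto simp: zero_def)
    then have "w \<bullet> \<eta> = - (?q \<bullet> normal S F)"
      using dual_basis(1)[OF F(1,2)] by (simp add: F(3) \<zeta>_def inner_diff_right inner_commute[of w])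
    then have "w \<bullet> \<eta> \<noteq> 0" using q[OF F(1)] by simp
    moreover have "w \<in> coord S" using facetsD[OF F(1)] F(2) verts_coord by blast
    ultimately show ?thesis by blast
  qed
  ultimately obtain z where z: "z \<in> coord S" "\<And>\<eta>. \<eta> \<in> Z \<Longrightarrow> z \<bullet> \<eta> \<noteq> 0"
    using avoid_hyperplanes[of Z "coord S"] coord_subspace by blast
  have "eventually (\<lambda>\<delta>. (\<forall>j\<in>S. snd n0 $ j + \<delta> * (snd z $ j) > 0) \<and>
      (\<forall>F\<in>facets S. n0 \<bullet> normal S F + \<delta> * (z \<bullet> normal S F) > 0) \<and>
      (\<forall>F\<in>G. (n0 \<bullet> normal S F - snd n0 $ i * (v \<bullet> normal S F)) +
         \<delta> * (z \<bullet> normal S F - snd z $ i * (v \<bullet> normal S F)) > 0) \<and>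
      (\<forall>\<eta>\<in>Z. n0 \<bullet> \<eta> + \<delta> * (z \<bullet> \<eta>) \<noteq> 0)) (at_right 0)"
    using n0p n0n n0g z \<open>finite Z\<close>
    by (intro eventually_conj eventually_ball_finite finite_facets ballI finite G(1))
       (auto simp: G(2) intro!: eventually_affine_pos eventually_affine_nonzero)
  from ev[OF this] obtain \<delta> where \<delta>: "(\<forall>j\<in>S. snd n0 $ j + \<delta> * (snd z $ j) > 0) \<and>
      (\<forall>F\<in>facets S. n0 \<bullet> normal S F + \<delta> * (z \<bullet> normal S F) > 0) \<and>
      (\<forall>F\<in>G. (n0 \<bullet> normal S F - snd n0 $ i * (v \<bullet> normal S F)) +
         \<delta> * (z \<bullet> normal S F - snd z $ i * (v \<bullet> normal S F)) > 0) \<and>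
      (\<forall>\<eta>\<in>Z. n0 \<bullet> \<eta> + \<delta> * (z \<bullet> \<eta>) \<noteq> 0)" by blast
  define n where "n = n0 + \<delta> *\<^sub>R z"
  have nc: "n \<in> coord S"
    unfolding n_def using n0c z(1) coord_subspace by (simp add: subspace_add subspace_scale)
  have np: "snd n $ j > 0" if "j \<in> S" for j using \<delta> that by (simp add: n_def)
  have nn: "n \<bullet> normal S F > 0" if "F \<in> facets S" for F
    using \<delta> that by (simp add: n_def inner_add_left)
  have ng: "n \<bullet> normal S F - snd n $ i * (v \<bullet> normal S F) > 0" if "F \<in> G" for F
  proof -
    have "(n0 \<bullet> normal S F - snd n0 $ i * (v \<bullet> normal S F)) +
         \<delta> * (z \<bullet> normal S F - snd z $ i * (v \<bullet> normal S F)) > 0" using \<delta> that by blast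
    then show ?thesis by (simp add: n_def inner_add_left algebra_simps)
  qed
  have n\<zeta>: "n \<bullet> \<zeta> F w \<noteq> 0" if "F \<in> facets S" "w \<in> F" for F w
  proof -
    have "\<zeta> F w \<in> Z" using that unfolding Z_def by blast
    then show ?thesis using \<delta> by (simp add: n_def inner_add_left)
  qed
  define \<alpha> where "\<alpha> x F w = (x - ((x \<bullet> normal S F) / (n \<bullet> normal S F)) *\<^sub>R n) \<bullet> dual_basis F w" for x F w
  have \<alpha>q: "\<alpha> ?q F w \<noteq> 0" if "F \<in> facets S" "w \<in> F" for F w
  proof
    assume "\<alpha> ?q F w = 0"
    then have "(n \<bullet> normal S F) * (?q \<bullet> dual_basis F w) = (?q \<bullet> normal S F) * (n \<bullet> dual_basis F w)"
      using nn[OF that(1)] by (simp add: \<alpha>_def inner_diff_left field_simps)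
    then show False using n\<zeta>[OF that] by (simp add: \<zeta>_def inner_diff_right mult.commute)
  qed
  have \<alpha>v: "\<alpha> v F v = 1" if "F \<in> facets S" "v \<in> F" for F
    using vF[OF that] dual_basis(1)[OF that] by (simp add: \<alpha>_def inner_commute)
  \<comment> \<open>A coefficient that vanishes at v has nonzero slope
    \<open>\<alpha> ?q F w\<close>, so adding a small multiple of the centre to v makes it nonzero.
    At a facet through v the coefficient of v starts at 1 and stays positive.\<close>
  have "eventually (\<lambda>\<epsilon>. (\<forall>F\<in>facets S. \<forall>w\<in>F. \<alpha> v F w + \<epsilon> * \<alpha> ?q F w \<noteq> 0) \<and>
      (\<forall>F\<in>facets S. v \<in> F \<longrightarrow> \<alpha> v F v + \<epsilon> * \<alpha> ?q F v > 0) \<and>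
      (\<forall>F\<in>G. (n \<bullet> normal S F - snd n $ i * (v \<bullet> normal S F)) +
         \<epsilon> * (?N * (n \<bullet> normal S F) - snd n $ i * (?q \<bullet> normal S F)) > 0)) (at_right 0)"
    using \<alpha>q \<alpha>v ng facetsD
    by (intro eventually_conj eventually_ball_finite finite_facets ballI G(1))
       (auto simp: G(2) intro!: eventually_affine_pos eventually_affine_nonzero)
  from ev[OF this] obtain \<epsilon> where \<epsilon>: "\<epsilon> > 0 \<and> (\<forall>F\<in>facets S. \<forall>w\<in>F. \<alpha> v F w + \<epsilon> * \<alpha> ?q F w \<noteq> 0) \<and>
      (\<forall>F\<in>facets S. v \<in> F \<longrightarrow> \<alpha> v F v + \<epsilon> * \<alpha> ?q F v > 0) \<and>
      (\<forall>F\<in>G. (n \<bullet> normal S F - snd n $ i * (v \<bullet> normal S F)) +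
         \<epsilon> * (?N * (n \<bullet> normal S F) - snd n $ i * (?q \<bullet> normal S F)) > 0)" by blast
  define p where "p = v + \<epsilon> *\<^sub>R ?q"
  have pc: "p \<in> coord S"
    unfolding p_def using vc qc coord_subspace by (simp add: subspace_add subspace_scale)
  have \<alpha>p: "\<alpha> p F w = \<alpha> v F w + \<epsilon> * \<alpha> ?q F w" for F w
    by (simp add: \<alpha>_def p_def inner_add_left inner_diff_left add_divide_distrib algebra_simps)
  have "snd p $ j = 0" if "j \<in> S - {i}" for j
    using that snd_layer[OF v] by (simp add: p_def snd_centre)
  moreover have "p \<bullet> normal S F > 0" if "F \<in> facets S" for F
    using vn[OF that] q[OF that] \<epsilon> by (simp add: p_def inner_add_left add_nonneg_pos)
  moreover have "snd p $ i * (n \<bullet> normal S F) > snd n $ i * (p \<bullet> normal S F)"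
    if "F \<in> G" for F
  proof -
    have "(n \<bullet> normal S F - snd n $ i * (v \<bullet> normal S F)) +
         \<epsilon> * (?N * (n \<bullet> normal S F) - snd n $ i * (?q \<bullet> normal S F)) > 0" using \<epsilon> that by blast
    moreover have "snd p $ i = 1 + \<epsilon> * ?N" using snd_layer[OF v] by (simp add: p_def snd_centre)
    ultimately show ?thesis by (simp add: p_def inner_add_left algebra_simps)
  qed
  moreover have "\<alpha> p F w \<noteq> 0" if "F \<in> facets S" "w \<in> F" for F w using \<epsilon> that \<alpha>p by simp
  moreover have "\<alpha> p F v > 0" if "F \<in> facets S" "v \<in> F" for F using \<epsilon> that \<alpha>p by simp
  ultimately show ?thesis
    using nc pc np nn unfolding \<alpha>_def G_def by (intro exI[of _ n] exI[of _ p] conjI ballI impI) auto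
qed

subsection \<open>Line shelling\<close>

text \<open>The relative complex called \<open>Q\<close> in the introduction.\<close>

definition partial :: "'m set \<Rightarrow> 'm \<Rightarrow> ('a \<times> (real^'m)) set set" where
  "partial S i = {\<sigma> \<in> cplx S. \<forall>j\<in>S - {i}. \<sigma> \<inter> layer j \<noteq> {}}"

text \<open>The parameter \<open>r F\<close> says where the line p - r n meets the hyperplane of F.
  Among the facets that contain \<sigma>, one with least \<open>r\<close> satisfies
  \<open>R F \<subseteq> \<sigma>\<close>. Conversely, if \<open>R F \<subseteq> \<sigma>\<close>
  and \<sigma> lies in F and in F', then \<open>\<psi> F \<bullet> normal S F'\<close> is a sum of
  nonnegative terms, so \<open>r F \<le> r F'\<close>. Two candidates thus have equal parameters,
  and genericity makes them coincide.\<close>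

lemma line_shelling:
  assumes i: "i \<in> S" and v: "v \<in> layer i"
  shows "\<exists>R. (\<forall>F\<in>facets S. R F \<subseteq> F \<and> R F \<in> partial S i \<and> (v \<in> F \<longrightarrow> v \<notin> R F)) \<and>
    (\<forall>\<sigma>\<in>partial S i. \<exists>!F. F \<in> facets S \<and> R F \<subseteq> \<sigma> \<and> \<sigma> \<subseteq> F)"
proof -
  have vS: "v \<in> verts S" using i v by (auto simp: verts_def)
  obtain n p where np: "n \<in> coord S" "p \<in> coord S" "\<forall>j\<in>S. snd n $ j > 0" "\<forall>j\<in>S - {i}. snd p $ j = 0"
    and pos: "\<forall>F\<in>facets S. n \<bullet> normal S F > 0 \<and> p \<bullet> normal S F > 0"
    and gen: "\<forall>F\<in>facets S. \<forall>w\<in>F.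
      (p - ((p \<bullet> normal S F) / (n \<bullet> normal S F)) *\<^sub>R n) \<bullet> dual_basis F w \<noteq> 0"
    and genv: "\<forall>F\<in>facets S. v \<in> F \<longrightarrow>
      (p - ((p \<bullet> normal S F) / (n \<bullet> normal S F)) *\<^sub>R n) \<bullet> dual_basis F v > 0"
    and good: "\<forall>F\<in>facets S. S \<noteq> {i} \<or> v \<in> F \<longrightarrow>
      snd p $ i * (n \<bullet> normal S F) > snd n $ i * (p \<bullet> normal S F)"
    using generic_line[OF assms] by (elim exE conjE) (rule that)
  define r where "r F = (p \<bullet> normal S F) / (n \<bullet> normal S F)" for F
  define \<psi> where "\<psi> F = p - r F *\<^sub>R n" for F
  define a where "a F w = \<psi> F \<bullet> dual_basis F w" for F w
  define R where "R F = {w \<in> F. a F w < 0}" for F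
  have r: "r F > 0" if "F \<in> facets S" for F using pos that by (simp add: r_def)
  have a0: "a F w \<noteq> 0" if "F \<in> facets S" "w \<in> F" for F w
    using gen that by (simp add: a_def \<psi>_def r_def)
  have \<psi>c: "\<psi> F \<in> coord S" for F
    unfolding \<psi>_def using np coord_subspace by (simp add: subspace_diff subspace_scale)
  have \<psi>n: "\<psi> F \<bullet> normal S F = 0" if "F \<in> facets S" for F
    using pos that by (auto simp: \<psi>_def r_def inner_diff_left)
  have expand: "\<psi> F = (\<Sum>w\<in>F. a F w *\<^sub>R w)" if "F \<in> facets S" for F
    unfolding a_def by (rule facet_expansion[OF that \<psi>c \<psi>n[OF that]])
  have expand': "\<psi> F \<bullet> y = (\<Sum>w\<in>F. a F w * (w \<bullet> y))" if "F \<in> facets S" for F y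
    by (subst expand[OF that]) (simp add: inner_sum_left)
  have \<psi>F': "\<psi> F \<bullet> normal S F' = (r F' - r F) * (n \<bullet> normal S F')" if "F' \<in> facets S" for F F'
    using pos that by (auto simp: \<psi>_def r_def inner_diff_left field_simps)
  \<comment> \<open>In colour j the point \<open>p\<close> has coordinate 0 and \<open>n\<close> a
    positive one, so \<open>\<psi> F\<close> has a negative one. Without a vertex of colour j in
    \<open>R F\<close> the expansion over F would make it nonnegative.\<close>
  have Rlayer: "R F \<inter> layer j \<noteq> {}" if F: "F \<in> facets S" and j: "j \<in> S - {i}" for F j
  proof
    assume empty: "R F \<inter> layer j = {}"
    have "snd (\<psi> F) $ j = (\<Sum>w\<in>F. a F w * snd w $ j)"
      by (subst expand[OF F]) (simp add: snd_sum)
    also have "\<dots> \<ge> 0"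
    proof (rule sum_nonneg)
      fix w assume w: "w \<in> F"
      then obtain k where k: "w \<in> layer k" using facetsD[OF F] by (auto simp: verts_def)
      show "a F w * snd w $ j \<ge> 0"
      proof (cases "k = j")
        case True
        then have "w \<notin> R F" using empty k by blast
        then have "a F w \<ge> 0" using w by (simp add: R_def)
        then show ?thesis by (simp add: snd_layer[OF k])
      qed (simp add: snd_layer[OF k])
    qed
    finally have "r F * snd n $ j \<le> 0" using np(4) j by (simp add: \<psi>_def)
    moreover have "r F * snd n $ j > 0" using r[OF F] np(3) j by (intro mult_pos_pos) auto
    ultimately show False by simp
  qed
  have Rsub: "R F \<subseteq> F" for F by (auto simp: R_def)
  have "R F \<in> partial S i" if F: "F \<in> facets S" for F
    using Rlayer[OF F] cplx_down[OF _ Rsub] facetsD[OF F] unfolding partial_def by blast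
  moreover have "v \<notin> R F" if "F \<in> facets S" "v \<in> F" for F
    using genv that by (auto simp: R_def a_def \<psi>_def r_def)
  moreover have "\<exists>!F. F \<in> facets S \<and> R F \<subseteq> \<sigma> \<and> \<sigma> \<subseteq> F" if \<sigma>: "\<sigma> \<in> partial S i" for \<sigma>
  proof (rule ex_ex1I)
    have "{F \<in> facets S. \<sigma> \<subseteq> F} \<noteq> {}"
      using in_facet[of \<sigma> S] \<sigma> i by (auto simp: partial_def)
    then obtain F where "is_arg_min r (\<lambda>F. F \<in> {F \<in> facets S. \<sigma> \<subseteq> F}) F"
      using ex_is_arg_min_if_finite[of "{F \<in> facets S. \<sigma> \<subseteq> F}" r] finite_facets by auto
    then have F: "F \<in> facets S" "\<sigma> \<subseteq> F" and min: "\<And>F'. F' \<in> facets S \<Longrightarrow> \<sigma> \<subseteq> F' \<Longrightarrow> r F \<le> r F'"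
      by (auto simp: is_arg_min_linorder)
    (* Otherwise r decreases from F along the edge dual to F - {w}.  Its other end is a facet
       containing \<sigma>, against the choice of F, or (0, axis i 1), which the condition "good" excludes. *)
    have "R F \<subseteq> \<sigma>"
    proof (rule ccontr)
      assume "\<not> R F \<subseteq> \<sigma>"
      then obtain w where w: "w \<in> F" "a F w < 0" "w \<notin> \<sigma>" unfolding R_def by blast
      let ?u = "dual_basis F w" and ?yF = "normal S F"
      define B where "B = verts S - F"
      note yF = normal[OF F(1)]
      have "\<exists>s. (\<forall>x\<in>B. x \<bullet> ?u + s * (x \<bullet> ?yF) \<ge> 0) \<and> (\<exists>x\<in>B. x \<bullet> ?u + s * (x \<bullet> ?yF) = 0)"
      proof (rule tight_shift)
        obtain x where "x \<in> layer i" "x \<bullet> ?yF \<noteq> 0" using layer_nonconstant[OF yF(2)] by blast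
        then have "x \<in> verts S" "x \<notin> zero S ?yF" using i by (auto simp: verts_def zero_def)
        then show "B \<noteq> {}" using yF(3) by (auto simp: B_def)
        show "x \<bullet> ?yF > 0" if "x \<in> B" for x
        proof -
          have "x \<in> verts S" "x \<notin> zero S ?yF" using that yF(3) by (auto simp: B_def)
          then have "x \<bullet> ?yF \<ge> 0" "x \<bullet> ?yF \<noteq> 0" using yF(1) by (auto simp: dual_def zero_def)
          then show ?thesis by simp
        qed
      qed (simp add: B_def)
      then obtain s where s: "(\<forall>x\<in>B. x \<bullet> ?u + s * (x \<bullet> ?yF) \<ge> 0) \<and> (\<exists>x\<in>B. x \<bullet> ?u + s * (x \<bullet> ?yF) = 0)" ..
      then obtain x0 where x0: "x0 \<in> B" "x0 \<bullet> ?u + s * (x0 \<bullet> ?yF) = 0" by blast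
      \<comment> \<open>This functional is 1 at w and 0 at x0 and on the rest of F. Since
        \<open>\<psi> F\<close> lies in the hyperplane of F, its value under y is the negative
        coefficient \<open>a F w\<close>.\<close>
      define y where "y = ?u + s *\<^sub>R ?yF"
      have yx: "x \<bullet> y = (if x = w then 1 else 0)" if x: "x \<in> F" for x
      proof -
        have "x \<bullet> ?yF = 0" using x yF(3) by (auto simp: zero_def)
        then show ?thesis using dual_basis[OF F(1) w(1)] x by (auto simp: y_def inner_add_right inner_commute)
      qed
      have y: "y \<in> dual S" unfolding dual_def
      proof (intro CollectI ballI)
        fix x assume "x \<in> verts S"
        then show "x \<bullet> y \<ge> 0"
          using yx[of x] s by (cases "x \<in> F") (auto simp: B_def y_def inner_add_right)
      qed
      have \<psi>y: "\<psi> F \<bullet> y < 0"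
        using w(2) \<psi>n[OF F(1)] by (simp add: y_def inner_add_right a_def)
      show False
      proof (cases "fst y = 0")
        case False
        let ?F' = "zero S y"
        have "insert x0 (F - {w}) \<subseteq> ?F'"
          using x0 yx facetsD[OF F(1)] by (auto simp: zero_def B_def y_def inner_add_right)
        then have "card (insert x0 (F - {w})) \<le> card ?F'" by (intro card_mono) auto
        moreover have "x0 \<notin> F" using x0 by (simp add: B_def)
        ultimately have "card F \<le> card ?F'" using w(1) facetsD[OF F(1)]
          by (simp add: card_Suc_Diff1)
        then have "card ?F' + 1 = DIM('a) + card S"
          using card_zero[OF y False] facetsD[OF F(1)] by simp
        then have F': "?F' \<in> facets S" using zero_facet[OF y False] by blast
        have "\<sigma> \<subseteq> ?F'" using \<open>insert x0 (F - {w}) \<subseteq> ?F'\<close> F(2) w(3) by blast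
        then have "r F \<le> r ?F'" using min[OF F'] by blast
        then have "\<psi> F \<bullet> normal S ?F' \<ge> 0" 
          using \<psi>F'[OF F'] pos F' by (simp add: less_imp_le)
        moreover obtain l where "l > 0" "\<forall>\<xi>\<in>coord S. \<xi> \<bullet> normal S ?F' = l * (\<xi> \<bullet> y)"
          using dual_proportional[OF i y False normal(1,2)[OF F']] normal(3)[OF F'] F' by auto
        ultimately have "l * (\<psi> F \<bullet> y) \<ge> 0" using \<psi>c by auto
        then show False using \<open>l > 0\<close> \<psi>y by (simp add: zero_le_mult_iff)
      next
        \<comment> \<open>F uses every colour, so on \<open>coord S\<close> the functional y is the
          coordinate of a colour j0 whose only vertex in F is w. As \<sigma> omits w, it omits
          colour j0, and a face of \<open>partial S i\<close> can omit only i.\<close>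
        case True
        have layer_y: "x \<bullet> y = snd y $ j" if "x \<in> layer j" for x j
          using layer_inner[OF that] True by simp
        obtain j0 where j0: "j0 \<in> S" "w \<in> layer j0"
          using w(1) facetsD[OF F(1)] by (auto simp: verts_def)
        have yj: "snd y $ j = (if j = j0 then 1 else 0)" if j: "j \<in> S" for j
        proof (cases "j = j0")
          case True
          then show ?thesis using layer_y[OF j0(2)] yx[OF w(1)] by simp
        next
          case False
          obtain x where x: "x \<in> F" "x \<in> layer j" using facet_layer[OF F(1) j] by blast
          then have "x \<noteq> w" using layer_disjoint[OF j0(2)] False by blast
          then show ?thesis using layer_y[OF x(2)] yx[OF x(1)] False by simp
        qed
        have "\<psi> F \<bullet> y = \<psi> F \<bullet> (0, axis j0 1)"
          using \<psi>c by (rule coord_inner_cong) (use True yj in \<open>auto simp: axis_def\<close>)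
        then have neg: "snd (\<psi> F) $ j0 < 0"
          using \<psi>y by (simp add: inner_prod_def inner_axis)
        have \<sigma>0: "\<sigma> \<inter> layer j0 = {}"
        proof (rule ccontr)
          assume "\<sigma> \<inter> layer j0 \<noteq> {}"
          then obtain x where x: "x \<in> \<sigma>" "x \<in> layer j0" by blast
          then have "x \<bullet> y = 1" using layer_y yj[OF j0(1)] by simp
          moreover have "x \<noteq> w" "x \<in> F" using x w(3) F(2) by auto
          ultimately show False using yx by simp
        qed
        then have "j0 = i" using \<sigma> j0(1) by (auto simp: partial_def)
        \<comment> \<open>The sign condition holds at F itself unless S = {i}. In that case \<sigma>
          is empty, and a facet through v serves as F0. Its parameter is at least
          \<open>r F\<close>, so the colour-i coordinate of \<open>\<psi> F\<close> is at least that
          of \<open>\<psi> F0\<close>, which is positive.\<close>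
        have "\<exists>F0\<in>facets S. \<sigma> \<subseteq> F0 \<and> (S \<noteq> {i} \<or> v \<in> F0)"
        proof (cases "S = {i}")
          case True
          then have "\<sigma> = {}" using \<sigma>0 \<sigma> \<open>j0 = i\<close> cplx_subset[of \<sigma> S]
            by (auto simp: partial_def verts_def)
          then show ?thesis using in_facet[OF vertex_in_cplx[OF vS]] i by blast
        qed (use F in blast)
        then obtain F0 where F0: "F0 \<in> facets S" "\<sigma> \<subseteq> F0" "S \<noteq> {i} \<or> v \<in> F0" by blast
        then have "snd p $ i * (n \<bullet> normal S F0) > snd n $ i * (p \<bullet> normal S F0)" using good by blast
        then have "snd n $ i * r F0 < snd p $ i"
          using pos F0(1) by (simp add: r_def field_simps)
        moreover have "snd n $ i * r F \<le> snd n $ i * r F0"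
          using min[OF F0(1,2)] np(3) i by (intro mult_left_mono) (auto simp: less_imp_le)
        ultimately have "snd (\<psi> F) $ i > 0" by (simp add: \<psi>_def mult.commute)
        then show False using neg \<open>j0 = i\<close> by simp
      qed
    qed
    then show "\<exists>F. F \<in> facets S \<and> R F \<subseteq> \<sigma> \<and> \<sigma> \<subseteq> F" using F by blast
  next
    have nonneg: "a F w * (w \<bullet> normal S F') \<ge> 0"
      if "F \<in> facets S" "R F \<subseteq> \<sigma>" "F' \<in> facets S" "\<sigma> \<subseteq> F'" "w \<in> F" for F F' w
    proof (cases "w \<in> \<sigma>")
      case True
      then have "w \<bullet> normal S F' = 0" using normal(3)[OF that(3)] that(4) by (auto simp: zero_def)
      then show ?thesis by simp
    next
      case False
      then have "a F w \<ge> 0" using that by (force simp: R_def)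
      moreover have "w \<bullet> normal S F' \<ge> 0"
        using normal(1)[OF that(3)] facetsD[OF that(1)] that(5) by (auto simp: dual_def)
      ultimately show ?thesis by simp
    qed
    have le: "r F \<le> r F'"
      if "F \<in> facets S" "R F \<subseteq> \<sigma>" "F' \<in> facets S" "\<sigma> \<subseteq> F'" for F F'
    proof -
      have "\<psi> F \<bullet> normal S F' \<ge> 0" unfolding expand'[OF that(1)]
        by (rule sum_nonneg, rule nonneg[OF that])
      then have "(r F' - r F) * (n \<bullet> normal S F') \<ge> 0" using \<psi>F'[OF that(3)] by simp
      moreover have "n \<bullet> normal S F' > 0" using pos that(3) by blast
      ultimately show ?thesis by (simp add: zero_le_mult_iff)
    qed
    fix F F' assume *: "F \<in> facets S \<and> R F \<subseteq> \<sigma> \<and> \<sigma> \<subseteq> F" "F' \<in> facets S \<and> R F' \<subseteq> \<sigma> \<and> \<sigma> \<subseteq> F'"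
    then have "r F = r F'" using le[of F F'] le[of F' F] by simp
    then have "(\<Sum>w\<in>F. a F w * (w \<bullet> normal S F')) = 0"
      using expand'[of F "normal S F'"] \<psi>F'[of F' F] * by simp
    then have zero: "a F w * (w \<bullet> normal S F') = 0" if "w \<in> F" for w
      using sum_nonneg_eq_0_iff[of F "\<lambda>w. a F w * (w \<bullet> normal S F')"] nonneg[of F F'] * facetsD[of F S] that
      by simp
    \<comment> \<open>Here genericity enters: no coefficient \<open>a F w\<close> is zero, so every
      vertex of F lies on the hyperplane of F'.\<close>
    have "w \<in> zero S (normal S F')" if "w \<in> F" for w
      using zero[OF that] a0[of F w] that * facetsD[of F S] by (auto simp: zero_def)
    then have "F \<subseteq> F'" using normal(3)[of F' S] * by blast
    then show "F = F'" using facetsD[of F S] facetsD[of F' S] * by (intro card_seteq) auto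
  qed
  ultimately show ?thesis using Rsub by (intro exI[of _ R]) blast
qed

subsection \<open>The recursion and its defect\<close>

text \<open>The faces of the relative complex: a face in \<open>cplx S\<close> lies in some
  \<open>cplx (S - {i})\<close> exactly when it misses a colour.\<close>

definition mixed :: "'m set \<Rightarrow> ('a \<times> (real^'m)) set set" where
  "mixed S = {\<sigma> \<in> cplx S. \<forall>j\<in>S. \<sigma> \<inter> layer j \<noteq> {}}"

definition h :: "'m set \<Rightarrow> int poly" where
  "h S = face_poly (DIM('a) + card S - 1) (mixed S)"

definition h_coeff :: "'m set \<Rightarrow> int \<Rightarrow> int" where
  "h_coeff S k = (if k < 0 then 0 else coeff (h S) (nat k))"

definition g_coeff :: "'m set \<Rightarrow> int \<Rightarrow> int" where
  "g_coeff S k = h_coeff S k - h_coeff S (k - 1)"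

definition gap :: "'m set \<Rightarrow> 'm \<Rightarrow> 'a \<times> (real^'m) \<Rightarrow> nat \<Rightarrow> int" where
  "gap S i x K = coeff (h S + [:1, -1:] * h (S - {i})) K
     - coeff (star_poly (DIM('a) + card S - 1) (mixed S) x) K"

text \<open>Right-hand side minus left-hand side of the recursion, indexed by k = i + |S| - 1, the
  index of the h-number.\<close>

definition excess :: "'m set \<Rightarrow> int \<Rightarrow> int" where
  "excess S k = (int (card (verts S)) - int DIM('a) - int (card S)) * h_coeff S k
     + (\<Sum>j\<in>S. int (card (layer j)) * g_coeff (S - {j}) k) - (k + 1) * g_coeff S (k + 1)"

lemma card_cplx:
  assumes "\<sigma> \<in> cplx S"
  shows "card \<sigma> + 1 \<le> DIM('a) + card S"
proof -
  obtain y where y: "y \<in> dual S" "fst y \<noteq> 0" "\<sigma> \<subseteq> zero S y" using assms by (auto simp: cplx_def)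
  have "card \<sigma> \<le> card (zero S y)" using y(3) by (intro card_mono) auto
  then show ?thesis using card_zero[OF y(1,2)] by simp
qed

lemma verts_mono: "R \<subseteq> S \<Longrightarrow> verts R \<subseteq> verts S"
  by (auto simp: verts_def)

lemma cplx_mono:
  assumes "R \<subseteq> S" "\<sigma> \<in> cplx R"
  shows "\<sigma> \<in> cplx S"
  using assms cplx_eq[of \<sigma> R] cplx_eq[of \<sigma> S] verts_mono[of R S] by blast

lemma verts_layer: "x \<in> verts R \<Longrightarrow> x \<in> layer j \<Longrightarrow> j \<in> R"
  using layer_disjoint[of x] unfolding verts_def by blast

lemma finite_mixed: "finite (mixed S)"
  using finite_cplx by (simp add: mixed_def)

lemma partial_eq:
  assumes "i \<in> S"
  shows "partial S i = mixed S \<union> mixed (S - {i})" "mixed S \<inter> mixed (S - {i}) = {}"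
proof -
  have sub: "\<sigma> \<subseteq> verts (S - {i}) \<longleftrightarrow> \<sigma> \<inter> layer i = {}" if "\<sigma> \<in> cplx S" for \<sigma>
    using cplx_subset[OF that] verts_layer[of _ "S - {i}" i] by (fastforce simp: verts_def)
  have "\<sigma> \<in> cplx (S - {i}) \<longleftrightarrow> \<sigma> \<in> cplx S \<and> \<sigma> \<inter> layer i = {}" for \<sigma>
    using sub[of \<sigma>] cplx_eq[of \<sigma> S] cplx_eq[of \<sigma> "S - {i}"] verts_mono[of "S - {i}" S] by blast
  then show "partial S i = mixed S \<union> mixed (S - {i})" "mixed S \<inter> mixed (S - {i}) = {}"
    using assms unfolding partial_def mixed_def by blast+
qed

text \<open>The faces of \<open>mixed (S - {i})\<close> are counted here with a D larger by one than
  their own, which multiplies each of their terms by 1 - t.\<close>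

lemma face_poly_partial:
  assumes i: "i \<in> S"
  shows "face_poly (DIM('a) + card S - 1) (partial S i) = h S + [:1, -1:] * h (S - {i})"
proof -
  let ?D = "DIM('a) + card S - 1" and ?q = "[:1, -1:] :: int poly"
  have card: "card (S - {i}) + 1 = card S" using card.remove[of S i] i by simp
  have "face_poly ?D (mixed (S - {i})) = ?q * h (S - {i})"
    unfolding face_poly_def h_def sum_distrib_left
  proof (intro sum.cong refl)
    fix \<sigma> assume "\<sigma> \<in> mixed (S - {i})"
    then have "card \<sigma> + 1 \<le> DIM('a) + card (S - {i})" using card_cplx by (auto simp: mixed_def)
    then have "?D - card \<sigma> = Suc (DIM('a) + card (S - {i}) - 1 - card \<sigma>)" using card by simp
    then show "monom 1 (card \<sigma>) * ?q ^ (?D - card \<sigma>) =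
        ?q * (monom 1 (card \<sigma>) * ?q ^ (DIM('a) + card (S - {i}) - 1 - card \<sigma>))"
      by (simp only: power_Suc mult.left_commute)
  qed
  then show ?thesis
    unfolding partial_eq(1)[OF i] using partial_eq(2)[OF i] finite_mixed
    by (simp add: face_poly_def h_def sum.union_disjoint)
qed

text \<open>A face through x already has colour i, so \<open>mixed S\<close> and
  \<open>partial S i\<close> have the same faces through x, and \<open>coeff_star_poly\<close>
  applies. The partition is returned with the formula because both zero criteria below argue with
  its intervals.\<close>

lemma gap_eq_card:
  assumes i: "i \<in> S" and x: "x \<in> layer i"
  shows "\<exists>R. interval_partition (DIM('a) + card S - 1) (partial S i) (facets S) R \<and>
    (\<forall>F\<in>facets S. x \<in> F \<longrightarrow> x \<notin> R F) \<and>
    (\<forall>K. gap S i x K = int (card {F \<in> facets S. x \<notin> F \<and> card (R F) = K}))"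
proof -
  obtain R where R: "(\<forall>F\<in>facets S. R F \<subseteq> F \<and> R F \<in> partial S i \<and> (x \<in> F \<longrightarrow> x \<notin> R F)) \<and>
      (\<forall>\<sigma>\<in>partial S i. \<exists>!F. F \<in> facets S \<and> R F \<subseteq> \<sigma> \<and> \<sigma> \<subseteq> F)"
    using line_shelling[OF assms] ..
  have R1: "R F \<subseteq> F" "R F \<in> partial S i" "x \<in> F \<Longrightarrow> x \<notin> R F" if "F \<in> facets S" for F
    using R that by simp_all
  have R2: "\<exists>!F. F \<in> facets S \<and> R F \<subseteq> \<sigma> \<and> \<sigma> \<subseteq> F" if "\<sigma> \<in> partial S i" for \<sigma>
    using bspec[OF conjunct2[OF R] that] .
  have int: "interval_partition (DIM('a) + card S - 1) (partial S i) (facets S) R"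
  proof
    show "finite (partial S i)" using finite_cplx by (simp add: partial_def)
    show "finite (facets S)" by (rule finite_facets)
    show "finite F \<and> card F = DIM('a) + card S - 1 \<and> R F \<subseteq> F" if "F \<in> facets S" for F
    proof -
      have "card F = DIM('a) + card S - 1" using facetsD[OF that] by linarith
      then show ?thesis using facetsD[OF that] R1(1)[OF that] by simp
    qed
    show "\<exists>!F. F \<in> facets S \<and> R F \<subseteq> \<sigma> \<and> \<sigma> \<subseteq> F" if "\<sigma> \<in> partial S i" for \<sigma>
      using R2[OF that] .
    show "\<sigma> \<in> partial S i" if "F \<in> facets S" "R F \<subseteq> \<sigma>" "\<sigma> \<subseteq> F" for F \<sigma>
    proof -
      show ?thesis using R1(2)[OF that(1)]
        using cplx_down[of F S \<sigma>] facetsD[OF that(1)] that(2,3) unfolding partial_def by blast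
    qed
  qed
  have "{\<sigma>. \<sigma> \<in> mixed S \<and> x \<in> \<sigma>} = {\<sigma>. \<sigma> \<in> partial S i \<and> x \<in> \<sigma>}"
    using i x unfolding mixed_def partial_def by blast
  then have star: "star_poly (DIM('a) + card S - 1) (mixed S) x = star_poly (DIM('a) + card S - 1) (partial S i) x"
    by (simp only: star_poly_def)
  have "gap S i x K = int (card {F \<in> facets S. x \<notin> F \<and> card (R F) = K})" for K
    unfolding gap_def face_poly_partial[OF i, symmetric] star
    using interval_partition.coeff_star_poly[OF int, of x] R1(3) by blast
  then show ?thesis using int R1(3) by (intro exI[of _ R]) simp
qed

lemma gap_nonneg: "i \<in> S \<Longrightarrow> x \<in> layer i \<Longrightarrow> gap S i x K \<ge> 0"
  using gap_eq_card[of i S x] by auto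

text \<open>Suppose F avoids x and \<open>R F\<close> has K elements. Adding x to \<open>R F\<close>
  gives a face in the interval of some F' that contains x. Since x is not in \<open>R F'\<close>,
  the set \<open>R F\<close> also lies in that interval, so F' = F, which is impossible.\<close>

lemma gap_zeroI:
  assumes i: "i \<in> S" and x: "x \<in> layer i"
    and faces: "\<And>\<tau>. \<tau> \<in> partial S i \<Longrightarrow> card \<tau> = K \<Longrightarrow> insert x \<tau> \<in> cplx S"
  shows "gap S i x K = 0"
proof -
  obtain R where int: "interval_partition (DIM('a) + card S - 1) (partial S i) (facets S) R"
    and xR: "\<forall>F\<in>facets S. x \<in> F \<longrightarrow> x \<notin> R F"
    and gap: "\<forall>K. gap S i x K = int (card {F \<in> facets S. x \<notin> F \<and> card (R F) = K})"
    using gap_eq_card[OF i x] by blast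
  interpret interval_partition "DIM('a) + card S - 1" "partial S i" "facets S" R by (rule int)
  have no_facet: "False" if F: "F \<in> facets S" "x \<notin> F" "card (R F) = K" for F
  proof -
    have RF: "R F \<in> partial S i" using interval[OF F(1), of "R F"] facet[OF F(1)] by blast
    then have "insert x (R F) \<in> partial S i"
      using faces[OF RF F(3)] unfolding partial_def by blast
    then obtain F' where F': "F' \<in> facets S" "R F' \<subseteq> insert x (R F)" "insert x (R F) \<subseteq> F'"
      using ex1_facet by blast
    then have "x \<notin> R F'" using xR by blast
    then have sub: "R F' \<subseteq> R F" "R F \<subseteq> F'" using F'(2,3) by blast+
    have "R F \<subseteq> F" using facet[OF F(1)] by blast
    from facet_unique[OF RF F'(1) sub F(1) subset_refl this] have "F' = F" .
    moreover have "x \<in> F'" using F'(3) by simp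
    ultimately show False using F(2) by simp
  qed
  have "{F \<in> facets S. x \<notin> F \<and> card (R F) = K} = {}" using no_facet by fast
  moreover have "gap S i x K = int (card {F \<in> facets S. x \<notin> F \<and> card (R F) = K})"
    using gap by (rule spec)
  ultimately show ?thesis by (simp only: card.empty of_nat_0)
qed

text \<open>If \<tau> is in the interval of F, then \<open>R F\<close> has at most K elements, and
  the vanishing gap at that size puts x into F. The size of \<open>R F\<close> is not known in
  advance, whence the assumption for all L \<le> K.\<close>

lemma gap_zeroD:
  assumes i: "i \<in> S" and x: "x \<in> layer i"
    and zero: "\<And>L. L \<le> K \<Longrightarrow> gap S i x L = 0"
    and \<tau>: "\<tau> \<in> partial S i" "card \<tau> \<le> K"
  shows "insert x \<tau> \<in> cplx S"
proof -
  obtain R where int: "interval_partition (DIM('a) + card S - 1) (partial S i) (facets S) R"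
    and gap: "\<forall>K. gap S i x K = int (card {F \<in> facets S. x \<notin> F \<and> card (R F) = K})"
    using gap_eq_card[OF i x] by blast
  interpret interval_partition "DIM('a) + card S - 1" "partial S i" "facets S" R by (rule int)
  obtain F where F: "F \<in> facets S" "R F \<subseteq> \<tau>" "\<tau> \<subseteq> F" using ex1_facet[OF \<tau>(1)] by blast
  have "finite \<tau>" using F facet[OF F(1)] finite_subset by blast
  then have "card (R F) \<le> K" using card_mono[OF _ F(2)] \<tau>(2) by simp
  then have "card {F' \<in> facets S. x \<notin> F' \<and> card (R F') = card (R F)} = 0"
    using spec[OF gap, of "card (R F)"] zero[of "card (R F)"] by simp
  then have "{F' \<in> facets S. x \<notin> F' \<and> card (R F') = card (R F)} = {}" using finite_facets by simp
  then have "x \<in> F" using F(1) by blast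
  then show ?thesis using cplx_down[of F S "insert x \<tau>"] facetsD[OF F(1)] F(3) by simp
qed

lemma sum_verts: "(\<Sum>x\<in>verts S. f x) = (\<Sum>j\<in>S. \<Sum>x\<in>layer j. f x)"
  unfolding verts_def using layer_disjoint
  by (intro sum.UNION_disjoint) (auto simp: finite_layer)

lemma excess_eq:
  "excess S k = (if k < 0 then 0 else \<Sum>i\<in>S. \<Sum>x\<in>layer i. gap S i x (nat k))"
proof (cases "k < 0")
  case True
  \<comment> \<open>At k = -1 the number \<open>g_coeff S 0\<close> may be nonzero, but its factor k
    + 1 is zero.\<close>
  then show ?thesis by (cases "k = -1") (auto simp: excess_def g_coeff_def h_coeff_def)
next
  case False
  define K where "K = nat k"
  have k: "k = int K" using False by (simp add: K_def)
  define D where "D = DIM('a) + card S - 1"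
  have D: "int D = int DIM('a) + int (card S) - 1"
    unfolding D_def using DIM_positive[where 'a='a] by linarith
  have g: "g_coeff S' (int K) = coeff ([:1, -1:] * h S') K" for S'
    by (cases K) (auto simp: g_coeff_def h_coeff_def nat_diff_distrib nat_add_distrib)
  have star: "(\<Sum>x\<in>verts S. coeff (star_poly D (mixed S) x) K) =
      (int K + 1) * coeff (h S) (Suc K) + (int D - int K) * coeff (h S) K"
    unfolding h_def D_def[symmetric]
  proof (rule coeff_sum_star_poly)
    show "\<sigma> \<subseteq> verts S \<and> card \<sigma> \<le> D" if "\<sigma> \<in> mixed S" for \<sigma>
      using that cplx_subset[of \<sigma> S] card_cplx[of \<sigma> S] by (auto simp: mixed_def D_def)
  qed (auto simp: finite_mixed)
  have "(\<Sum>i\<in>S. \<Sum>x\<in>layer i. gap S i x K) =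
      (\<Sum>i\<in>S. int (card (layer i)) * (coeff (h S) K + g_coeff (S - {i}) (int K)))
      - (\<Sum>x\<in>verts S. coeff (star_poly D (mixed S) x) K)"
    unfolding sum_verts by (simp add: gap_def D_def sum_subtractf g del: mult_pCons_left)
  also have "(\<Sum>i\<in>S. int (card (layer i)) * (coeff (h S) K + g_coeff (S - {i}) (int K))) =
      int (card (verts S)) * coeff (h S) K + (\<Sum>i\<in>S. int (card (layer i)) * g_coeff (S - {i}) (int K))"
  proof -
    have "int (card (verts S)) = (\<Sum>i\<in>S. int (card (layer i)))"
      using sum_verts[of "\<lambda>_. 1::int" S] by simp
    then show ?thesis by (simp add: distrib_left sum.distrib sum_distrib_right)
  qed
  finally have "(\<Sum>i\<in>S. \<Sum>x\<in>layer i. gap S i x K) = excess S k"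
    unfolding star by (simp add: excess_def k h_coeff_def D nat_add_distrib algebra_simps
      g_coeff_def[of S])
  then show ?thesis using False by (simp add: K_def)
qed

lemma excess_nonneg: "excess S k \<ge> 0"
  by (auto simp: excess_eq intro!: sum_nonneg gap_nonneg)

lemma excess_eq_0_iff:
  "excess S (int K) = 0 \<longleftrightarrow> (\<forall>i\<in>S. \<forall>x\<in>layer i. gap S i x K = 0)"
proof -
  have "(\<Sum>i\<in>S. \<Sum>x\<in>layer i. gap S i x K) = 0 \<longleftrightarrow> (\<forall>i\<in>S. (\<Sum>x\<in>layer i. gap S i x K) = 0)"
    by (rule sum_nonneg_eq_0_iff) (auto intro!: sum_nonneg gap_nonneg)
  also have "\<dots> \<longleftrightarrow> (\<forall>i\<in>S. \<forall>x\<in>layer i. gap S i x K = 0)"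
    by (intro ball_cong refl sum_nonneg_eq_0_iff) (auto simp: finite_layer intro: gap_nonneg)
  finally show ?thesis by (simp add: excess_eq)
qed

text \<open>Induction on the size of \<sigma>: a vertex x of colour i is removed. If the rest misses
  colour i, the induction hypothesis is applied to S - {i}, where both sides of the size bound drop
  by one. The rest then lies in \<open>partial S i\<close>, and vanishing gaps allow x to be put
  back.\<close>

lemma excess_zero_imp_face:
  assumes zero: "\<And>k S. k \<le> k0 \<Longrightarrow> excess S (k + int (card S) - 1) = 0"
    and "\<sigma> \<subseteq> verts S" "\<forall>j\<in>S. \<sigma> \<inter> layer j \<noteq> {}" "int (card \<sigma>) \<le> k0 + int (card S)"
  shows "\<sigma> \<in> cplx S"
  using assms(2-4)
proof (induction "card \<sigma>" arbitrary: \<sigma> S rule: less_induct)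
  case less
  show ?case
  proof (cases "\<sigma> = {}")
    case True
    then show ?thesis by (simp add: empty_in_cplx)
  next
    case False
    then obtain x where x\<sigma>: "x \<in> \<sigma>" by blast
    then have "x \<in> verts S" using less.prems(1) by (rule subsetD[rotated])
    then obtain i where "i \<in> S" "x \<in> layer i" unfolding verts_def by (rule UN_E)
    note x = x\<sigma> this
    define \<tau> where "\<tau> = \<sigma> - {x}"
    have fin: "finite \<sigma>" using less.prems(1) by (rule finite_subset) simp
    have card: "card \<tau> + 1 = card \<sigma>" using card.remove[OF fin x(1)] by (simp add: \<tau>_def)
    have hit: "\<tau> \<inter> layer j \<noteq> {}" if j: "j \<in> S - {i}" for j
    proof -
      have "\<sigma> \<inter> layer j \<noteq> {}" using less.prems(2) j by simp
      moreover have "x \<notin> layer j" using layer_disjoint[OF x(3), of j] j by blast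
      ultimately show ?thesis unfolding \<tau>_def by blast
    qed
    have "\<tau> \<in> cplx S"
    proof (cases "\<tau> \<inter> layer i = {}")
      case True
      have "\<tau> \<subseteq> verts (S - {i})"
        using less.prems(1) True unfolding \<tau>_def verts_def by blast
      moreover have "card (S - {i}) + 1 = card S" using card.remove[of S i] x(2) by simp
      ultimately have "\<tau> \<in> cplx (S - {i})"
        using less.hyps[of \<tau> "S - {i}"] hit card less.prems(3) by simp
      then show ?thesis by (rule cplx_mono[rotated]) blast
    next
      case False
      have "\<forall>j\<in>S. \<tau> \<inter> layer j \<noteq> {}" using hit False by blast
      moreover have "\<tau> \<subseteq> verts S" using less.prems(1) by (auto simp: \<tau>_def)
      ultimately show ?thesis using less.hyps[of \<tau> S] card less.prems(3) by simp
    qed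
    then have \<tau>: "\<tau> \<in> partial S i" using hit by (simp add: partial_def)
    have "gap S i x L = 0" if "L \<le> card \<tau>" for L
    proof -
      \<comment> \<open>Since \<tau> has one vertex fewer than \<sigma>, the size bound gives L
        \<le> k0 + |S| - 1, the last index covered by the assumption.\<close>
      have "int L - int (card S) + 1 \<le> k0" using that card less.prems(3) by simp
      from zero[OF this, of S] have "excess S (int L) = 0" by simp
      then show ?thesis using excess_eq_0_iff x by blast
    qed
    from gap_zeroD[OF x(2,3) this \<tau>] show ?thesis
      using x(1) by (simp add: \<tau>_def insert_absorb)
  qed
qed

text \<open>A set of vertices lies in \<open>verts R\<close> for some proper subset R exactly when
  it misses a colour. The right side therefore says that every \<sigma> using all colours of S, with
  at most k0 + |S| elements, is a face. In the converse direction this applies to a face of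
  \<open>partial S i\<close> together with a vertex of colour i.\<close>

lemma excess_zero_iff_faces:
  "(\<forall>k\<le>k0. \<forall>S. excess S (k + int (card S) - 1) = 0) \<longleftrightarrow>
   (\<forall>S \<sigma>. \<sigma> \<subseteq> verts S \<and> \<sigma> \<notin> cplx S \<and> int (card \<sigma>) - 1 < k0 + int (card S)
      \<longrightarrow> (\<exists>R. R \<subset> S \<and> \<sigma> \<subseteq> verts R))"
proof (intro iffI allI impI)
  fix S \<sigma>
  assume zero: "\<forall>k\<le>k0. \<forall>S. excess S (k + int (card S) - 1) = 0"
    and \<sigma>: "\<sigma> \<subseteq> verts S \<and> \<sigma> \<notin> cplx S \<and> int (card \<sigma>) - 1 < k0 + int (card S)"
  then obtain j where j: "j \<in> S" "\<sigma> \<inter> layer j = {}"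
    using excess_zero_imp_face[of k0 \<sigma> S] by auto
  then have "\<sigma> \<subseteq> verts (S - {j})" using \<sigma> unfolding verts_def by blast
  then show "\<exists>R. R \<subset> S \<and> \<sigma> \<subseteq> verts R" using j(1) by (intro exI[of _ "S - {j}"]) blast
next
  fix k S
  assume nf: "\<forall>S \<sigma>. \<sigma> \<subseteq> verts S \<and> \<sigma> \<notin> cplx S \<and> int (card \<sigma>) - 1 < k0 + int (card S)
      \<longrightarrow> (\<exists>R. R \<subset> S \<and> \<sigma> \<subseteq> verts R)" and k: "k \<le> k0"
  show "excess S (k + int (card S) - 1) = 0"
  proof (cases "k + int (card S) - 1 < 0")
    case True
    then show ?thesis by (simp add: excess_eq)
  next
    case False
    then obtain K where K: "k + int (card S) - 1 = int K" by (metis nonneg_int_cases not_less)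
    have "gap S i x K = 0" if i: "i \<in> S" and x: "x \<in> layer i" for i x
    proof (rule gap_zeroI[OF i x])
      fix \<tau> assume \<tau>: "\<tau> \<in> partial S i" "card \<tau> = K"
      have sub: "insert x \<tau> \<subseteq> verts S"
        using \<tau>(1) cplx_subset[of \<tau> S] i x by (auto simp: partial_def verts_def)
      have "int (card (insert x \<tau>)) \<le> int K + 1"
        using \<tau>(2) card_insert_le_m1[of "K + 1" \<tau> x] by simp
      then have "int (card (insert x \<tau>)) - 1 < k0 + int (card S)" using K k by simp
      moreover have "\<not> insert x \<tau> \<subseteq> verts R" if "R \<subset> S" for R
      proof
        assume R: "insert x \<tau> \<subseteq> verts R"
        have "S \<subseteq> R"
        proof
          fix j assume j: "j \<in> S"
          then have "insert x \<tau> \<inter> layer j \<noteq> {}" using \<tau>(1) x unfolding partial_def by blast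
          then show "j \<in> R" using R verts_layer by blast
        qed
        then show False using that by blast
      qed
      ultimately show "insert x \<tau> \<in> cplx S"
        using spec[OF spec[OF nf, of S], of "insert x \<tau>"] sub by meson
    qed
    then show ?thesis unfolding K using excess_eq_0_iff by blast
  qed
qed

end

section \<open>Cayley complexes of simplicial polytopes\<close>

locale simplicial_family =
  fixes P :: "'m::finite \<Rightarrow> 'a::euclidean_space set"
  assumes simplicial: "simplicial_polytope (P i)"
    and full_dim: "aff_dim (P i) = int DIM('a)"
    and general_position: "relatively_general_position P"
begin

section \<open>From general position to independence of the lifted vertices\<close>

definition vertices :: "'m \<Rightarrow> 'a set" where
  "vertices i = {v. v extreme_point_of P i}"

lemma polytope_P: "polytope (P i)"
  using simplicial by (simp add: simplicial_polytope_def)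

lemma P_eq_hull: "P i = convex hull vertices i"
  using Krein_Milman_Minkowski[OF polytope_imp_compact[OF polytope_P] polytope_imp_convex[OF polytope_P]]
  unfolding vertices_def .

lemma finite_vertices: "finite (vertices i)"
  unfolding vertices_def by (rule finite_polyhedron_extreme_points[OF polytope_imp_polyhedron[OF polytope_P]])

lemma vertices_nonconstant:
  assumes "c \<noteq> 0"
  shows "\<exists>v\<in>vertices j. c \<bullet> v \<noteq> \<beta>"
proof (rule ccontr)
  assume "\<not> (\<exists>v\<in>vertices j. c \<bullet> v \<noteq> \<beta>)"
  then have "vertices j \<subseteq> {x. c \<bullet> x = \<beta>}" by blast
  then have "P j \<subseteq> {x. c \<bullet> x = \<beta>}"
    by (subst P_eq_hull) (rule hull_minimal, simp_all add: convex_hyperplane)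
  then have "aff_dim (P j) \<le> aff_dim {x. c \<bullet> x = \<beta>}" by (rule aff_dim_subset)
  then show False using full_dim assms by simp
qed

lemma vertices_supported:
  assumes "v \<in> vertices j"
  shows "\<exists>c. c \<noteq> 0 \<and> (\<forall>w\<in>vertices j. c \<bullet> w \<le> c \<bullet> v)"
proof -
  have "{v} exposed_face_of P j"
    using assms polytope_P
    by (simp add: exposed_face_of_polyhedron polytope_imp_polyhedron vertices_def face_of_singleton)
  moreover have "{v} \<noteq> P j"
  proof
    assume "{v} = P j"
    then have "aff_dim {v} = int DIM('a)" using full_dim[of j] by simp
    then show False using DIM_positive[where 'a='a] by simp
  qed
  ultimately obtain c b where c: "c \<noteq> 0" "P j \<subseteq> {x. c \<bullet> x \<le> b}" "{v} = P j \<inter> {x. c \<bullet> x = b}"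
    unfolding exposed_face_of by blast
  have "w \<in> P j" if "w \<in> vertices j" for w using that by (simp add: vertices_def extreme_point_of_def)
  then have "\<forall>w\<in>vertices j. c \<bullet> w \<le> b" using c(2) by blast
  moreover have "c \<bullet> v = b" using c(3) by blast
  ultimately show ?thesis using c(1) by blast
qed

text \<open>Full dimension makes the face of \<open>P j\<close> on which c is maximal proper, so it
  is a simplex and has one vertex more than its dimension. This is the vertex count for the
  independence proof.\<close>

lemma vertices_tight:
  fixes c :: 'a
  assumes "c \<noteq> 0"
  defines "M \<equiv> \<lambda>j. Max ((\<lambda>v. c \<bullet> v) ` vertices j)"
  defines "C \<equiv> \<lambda>j. P j \<inter> {x. c \<bullet> x = M j}"
  shows "\<And>j x. x \<in> P j \<Longrightarrow> c \<bullet> x \<le> M j"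
    and "\<And>j. C j face_of P j" and "\<And>j. C j \<noteq> P j" and "\<And>j. C j \<noteq> {}"
    and "\<And>j. C j = convex hull {v \<in> vertices j. c \<bullet> v = M j}"
    and "\<And>j. int (card {v \<in> vertices j. c \<bullet> v = M j}) = aff_dim (C j) + 1"
proof -
  have ne: "vertices j \<noteq> {}" for j using vertices_nonconstant[OF assms(1), of j 0] by blast
  have "P j \<subseteq> {x. c \<bullet> x \<le> M j}" for j
    by (subst P_eq_hull, rule hull_minimal) (auto simp: M_def finite_vertices convex_halfspace_le)
  then show le: "\<And>j x. x \<in> P j \<Longrightarrow> c \<bullet> x \<le> M j" by blast
  show face: "\<And>j. C j face_of P j"
    unfolding C_def by (rule face_of_Int_supporting_hyperplane_le) (auto simp: polytope_P polytope_imp_convex le)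
  have VP: "v \<in> P j" if "v \<in> vertices j" for v j
    using that by (simp add: vertices_def extreme_point_of_def)
  show proper: "\<And>j. C j \<noteq> P j"
    using vertices_nonconstant[OF assms(1)] VP unfolding C_def by blast
  have "M j \<in> (\<lambda>v. c \<bullet> v) ` vertices j" for j
    unfolding M_def using ne finite_vertices by (intro Max_in) auto
  then show nonempty: "\<And>j. C j \<noteq> {}" unfolding C_def using VP by fastforce
  fix j
  obtain K where K: "\<not> affine_dependent K" "C j = convex hull K"
    using simplicial[of j] face proper unfolding simplicial_polytope_def simplex_def by meson
  have "K = {v \<in> vertices j. c \<bullet> v = M j}"
  proof (rule set_eqI)
    fix v
    have "v \<in> K \<longleftrightarrow> v extreme_point_of C j"
      unfolding K(2) using extreme_point_of_convex_hull_affine_independent[OF K(1)] by simp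
    also have "\<dots> \<longleftrightarrow> v extreme_point_of P j \<and> v \<in> C j" by (rule extreme_point_of_face[OF face])
    also have "\<dots> \<longleftrightarrow> v \<in> {v \<in> vertices j. c \<bullet> v = M j}"
      by (auto simp: vertices_def C_def extreme_point_of_def)
    finally show "v \<in> K \<longleftrightarrow> v \<in> {v \<in> vertices j. c \<bullet> v = M j}" .
  qed
  then show "C j = convex hull {v \<in> vertices j. c \<bullet> v = M j}"
    "int (card {v \<in> vertices j. c \<bullet> v = M j}) = aff_dim (C j) + 1"
    using K aff_dim_affine_independent[OF K(1)] by (simp_all add: aff_dim_convex_hull)
qed

text \<open>The faces \<open>C j\<close> add up to the face of the Minkowski sum on which c is
  maximal. General position makes the sum of their dimensions the dimension of that face, hence at
  most \<open>dim L\<close>. The lifted vertices number this sum plus m, while their span has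
  dimension at least \<open>dim L\<close> + m.\<close>

lemma vertices_independent_max:
  fixes c :: 'a
  assumes "c \<noteq> 0"
  defines "M \<equiv> \<lambda>j. Max ((\<lambda>v. c \<bullet> v) ` vertices j)"
  shows "independent {(v, axis j (1::real)) |v j. v \<in> vertices j \<and> c \<bullet> v = M j}"
proof -
  define C where "C j = P j \<inter> {x. c \<bullet> x = M j}" for j
  define T where "T j = {v \<in> vertices j. c \<bullet> v = M j}" for j
  have M: "Max ((\<lambda>v. c \<bullet> v) ` vertices j) = M j" for j by (simp add: M_def)
  note tight = vertices_tight[OF assms(1), unfolded M, folded C_def T_def]
  define Z where "Z = {(v, axis j (1::real)) |v j. v \<in> vertices j \<and> c \<bullet> v = M j}"
  have Z_eq: "Z = (\<Union>j. T j \<times> {axis j 1})" unfolding Z_def T_def by blast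
  have finT: "finite (T j)" for j using finite_vertices by (simp add: T_def)
  then have finZ: "finite Z" by (simp add: Z_eq)
  have sumP: "sum P UNIV = {sum s UNIV |s. \<forall>i. s i \<in> P i}" using set_sum_alt[of UNIV P] by simp
  have sumC: "sum C UNIV = {sum s UNIV |s. \<forall>i. s i \<in> C i}" using set_sum_alt[of UNIV C] by simp
  have le: "c \<bullet> sum s UNIV \<le> sum M UNIV" if "\<forall>i. s i \<in> P i" for s
    unfolding inner_sum_right using tight(1) that by (intro sum_mono) auto
  have eq: "c \<bullet> sum s UNIV = sum M UNIV \<longleftrightarrow> (\<forall>i. s i \<in> C i)" if s: "\<forall>i. s i \<in> P i" for s
  proof -
    have "c \<bullet> sum s UNIV = sum M UNIV \<longleftrightarrow> (\<Sum>i\<in>UNIV. M i - c \<bullet> s i) = 0"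
      by (auto simp: inner_sum_right sum_subtractf)
    also have "\<dots> \<longleftrightarrow> (\<forall>i\<in>UNIV. M i - c \<bullet> s i = 0)"
      by (rule sum_nonneg_eq_0_iff) (use tight(1) s in auto)
    finally show ?thesis using s by (auto simp: C_def)
  qed
  have "sum C UNIV = sum P UNIV \<inter> {x. c \<bullet> x = sum M UNIV}"
  proof (intro set_eqI iffI)
    fix x assume "x \<in> sum C UNIV"
    then obtain s where s: "x = sum s UNIV" "\<forall>i. s i \<in> C i" by (auto simp: sumC)
    then have "\<forall>i. s i \<in> P i" by (auto simp: C_def)
    then show "x \<in> sum P UNIV \<inter> {x. c \<bullet> x = sum M UNIV}" using s eq[of s] by (auto simp: sumP)
  next
    fix x assume x: "x \<in> sum P UNIV \<inter> {x. c \<bullet> x = sum M UNIV}"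
    then obtain s where s: "x = sum s UNIV" "\<forall>i. s i \<in> P i" by (auto simp: sumP)
    then have "\<forall>i. s i \<in> C i" using eq[of s] x by simp
    then show "x \<in> sum C UNIV" using s by (auto simp: sumC)
  qed
  moreover have "convex (sum P UNIV)"
    by (rule convex_set_sum) (simp add: polytope_P polytope_imp_convex)
  ultimately have face: "sum C UNIV face_of sum P UNIV"
    using face_of_Int_supporting_hyperplane_le[of "sum P UNIV" c "sum M UNIV"] le by (auto simp: sumP)
  have "\<forall>j. \<exists>x. x \<in> C j" using tight(4) by blast
  from choice[OF this] obtain s0 where s0: "\<And>j. s0 j \<in> C j" by blast
  then have ne: "sum C UNIV \<noteq> {}" unfolding sumC by blast
  have proper: "sum C UNIV \<noteq> sum P UNIV"
  proof
    assume same: "sum C UNIV = sum P UNIV"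
    fix j :: 'm
    obtain w where w: "w \<in> P j" "w \<notin> C j" using tight(2,3)[of j] face_of_imp_subset by blast
    \<comment> \<open>Replacing one summand of a maximizing sum by a point that does not maximize c
      leaves the face, because a sum is maximal only if every summand is.\<close>
    define s where "s = s0(j := w)"
    have sP: "\<forall>i. s i \<in> P i" using w s0 by (auto simp: s_def C_def)
    then have "sum s UNIV \<in> sum C UNIV" unfolding same sumP by blast
    then have "c \<bullet> sum s UNIV = sum M UNIV"
      using eq unfolding sumC by (auto simp: C_def)
    then have "s j \<in> C j" using eq[OF sP] by blast
    then show False using w by (simp add: s_def)
  qed
  have aff: "aff_dim (sum C UNIV) = (\<Sum>i\<in>UNIV. aff_dim (C i))"
    using general_position face ne proper tight(2) unfolding relatively_general_position_def by blast
  have "\<exists>z. z \<in> T j" for j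
  proof (rule ccontr)
    assume "\<not> (\<exists>z. z \<in> T j)"
    then have "T j = {}" by blast
    then show False using tight(4,5)[of j] by simp
  qed
  then have "\<forall>j. \<exists>z. z \<in> T j" by blast
  from choice[OF this] obtain z where z: "\<And>j. z j \<in> T j" by blast
  \<comment> \<open>\<open>L\<close> contains the directions of all the \<open>C j\<close>, and
    therefore those of their Minkowski sum.\<close>
  define G where "G = (\<Union>j. (\<lambda>v. v - z j) ` T j)"
  define L where "L = span G"
  have "sum C UNIV \<subseteq> (+) (sum z UNIV) ` L"
  proof
    fix x assume "x \<in> sum C UNIV"
    then obtain s where s: "x = sum s UNIV" "\<forall>i. s i \<in> C i" by (auto simp: sumC)
    have "s j - z j \<in> L" for j
    proof -
      have "C j \<subseteq> {x. x - z j \<in> L}"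
        unfolding tight(5)
      proof (rule hull_minimal)
        show "T j \<subseteq> {x. x - z j \<in> L}" by (auto simp: L_def G_def intro!: span_base)
        have "{x. x - z j \<in> L} = (+) (z j) ` L"
          by (auto simp: image_iff intro!: bexI[of _ "_ - z j"])
        then show "convex {x. x - z j \<in> L}"
          by (simp add: convex_translation subspace_imp_convex L_def)
      qed
      then show ?thesis using s(2) by blast
    qed
    then have "sum (\<lambda>j. s j - z j) UNIV \<in> L" unfolding L_def by (intro span_sum) auto
    moreover have "x = sum z UNIV + sum (\<lambda>j. s j - z j) UNIV" by (simp add: s sum_subtractf)
    ultimately show "x \<in> (+) (sum z UNIV) ` L" by blast
  qed
  then have "aff_dim (sum C UNIV) \<le> aff_dim ((+) (sum z UNIV) ` L)" by (rule aff_dim_subset)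
  also have "\<dots> = int (dim L)" by (simp add: aff_dim_translation_eq aff_dim_subspace L_def)
  finally have dimL: "(\<Sum>i\<in>UNIV. aff_dim (C i)) \<le> int (dim L)" using aff by simp
  (* k embeds L \<times> UNIV into the span of Z, so Z has at most as many elements as its span has dimensions. *)
  define k where "k p = (fst p + (\<Sum>j\<in>UNIV. snd p $ j *\<^sub>R z j), snd p)" for p :: "'a \<times> (real^'m)"
  have link: "linear k"
    by (rule linearI) (auto simp: k_def scaleR_add_left sum.distrib scaleR_sum_right algebra_simps)
  have injk: "inj k" by (auto simp: inj_on_def k_def prod_eq_iff)
  have subL: "subspace L" by (simp add: L_def)
  have "dim (k ` (L \<times> UNIV)) = dim (L \<times> (UNIV :: (real^'m) set))"
    by (rule dim_image_eq[OF link]) (use injk in \<open>auto intro: inj_on_subset\<close>)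
  also have "\<dots> = dim L + dim (UNIV :: (real^'m) set)" by (rule dim_Times[OF subL subspace_UNIV])
  finally have dimk: "dim (k ` (L \<times> UNIV)) = dim L + CARD('m)" by simp
  have "k ` (L \<times> UNIV) \<subseteq> span Z"
  proof (intro image_subsetI)
    fix p assume "p \<in> L \<times> (UNIV :: (real^'m) set)"
    then have p: "fst p \<in> span G" by (auto simp: L_def)
    have zZ: "(z j, axis j 1) \<in> Z" for j using z[of j] by (auto simp: Z_eq)
    have "(\<lambda>x. (x, 0::real^'m)) ` span G \<subseteq> span Z"
    proof -
      have "linear (\<lambda>x::'a. (x, 0::real^'m))" by (rule linearI) auto
      then have "(\<lambda>x. (x, 0::real^'m)) ` span G = span ((\<lambda>x. (x, 0)) ` G)" 
        by (rule linear_span_image[symmetric])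
      also have "\<dots> \<subseteq> span Z"
      proof (rule span_minimal)
        show "(\<lambda>x. (x, 0)) ` G \<subseteq> span Z"
        proof (intro image_subsetI)
          fix x assume "x \<in> G"
          then obtain j v where "v \<in> T j" "x = v - z j" by (auto simp: G_def)
          then have "(x, 0) = (v, axis j (1::real)) - (z j, axis j 1)" "(v, axis j 1) \<in> Z"
            by (auto simp: Z_eq)
          then show "(x, 0) \<in> span Z" using zZ by (metis span_base span_diff)
        qed
      qed simp
      finally show ?thesis .
    qed
    then have "(fst p, 0) \<in> span Z" using p by blast
    moreover have "(\<Sum>j\<in>UNIV. snd p $ j *\<^sub>R (z j, axis j 1)) \<in> span Z"
      by (intro span_sum span_scale span_base zZ)
    moreover have "k p = (fst p, 0) + (\<Sum>j\<in>UNIV. snd p $ j *\<^sub>R (z j, axis j 1))"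
      by (auto simp: k_def prod_eq_iff fst_sum snd_sum vec_eq_iff axis_def if_distrib[of "(*) _"] cong: if_cong)
    ultimately show "k p \<in> span Z" by (simp add: span_add)
  qed
  then have "dim L + CARD('m) \<le> dim (span Z)" using dim_subset dimk by metis
  moreover have "card Z = (\<Sum>j\<in>UNIV. card (T j))"
  proof -
    have "card Z = (\<Sum>j\<in>UNIV. card (T j \<times> {axis j (1::real)}))"
      unfolding Z_eq by (rule card_UN_disjoint) (auto simp: finT axis_eq_axis)
    then show ?thesis by (simp add: card_cartesian_product)
  qed
  moreover have "int (\<Sum>j\<in>UNIV. card (T j)) = (\<Sum>j\<in>UNIV. aff_dim (C j)) + int CARD('m)"
    by (simp add: tight(6) sum.distrib)
  ultimately have "card Z \<le> dim (span Z)" using dimL by linarith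
  then have "independent Z" by (intro card_le_dim_spanning[of Z "span Z"] finZ span_superset) auto
  then show ?thesis unfolding Z_def .
qed

text \<open>For c = - fst y the cone condition says that \<open>snd y $ j\<close> bounds c on colour
  j. Tight vertices therefore maximize c in their colour, and the tight set is part of an
  independent set.\<close>

sublocale cayley_vertices vertices
proof
  show "finite (vertices j)" for j by (rule finite_vertices)
  show "\<exists>v\<in>vertices j. c \<bullet> v \<noteq> \<beta>" if "c \<noteq> 0" for c j \<beta> by (rule vertices_nonconstant[OF that])
  show "\<exists>c. c \<noteq> 0 \<and> (\<forall>w\<in>vertices j. c \<bullet> w \<le> c \<bullet> v)" if "v \<in> vertices j" for v j
    by (rule vertices_supported[OF that])
  fix y :: "'a \<times> (real^'m)"
  assume y: "\<forall>j. \<forall>v\<in>vertices j. (v, axis j 1) \<bullet> y \<ge> 0" "fst y \<noteq> 0"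
  define c where "c = - fst y"
  have c: "c \<noteq> 0" using y by (simp add: c_def)
  have in_y: "(v, axis j 1) \<bullet> y = snd y $ j - c \<bullet> v" for v j
    by (simp add: inner_prod_def inner_axis' c_def inner_commute[of v])
  have "{(v, axis j 1) |v j. v \<in> vertices j \<and> (v, axis j 1) \<bullet> y = 0} \<subseteq>
      {(v, axis j (1::real)) |v j. v \<in> vertices j \<and> c \<bullet> v = Max ((\<lambda>v. c \<bullet> v) ` vertices j)}"
  proof safe
    fix v j assume v: "v \<in> vertices j" "(v, axis j 1) \<bullet> y = 0"
    have "Max ((\<lambda>v. c \<bullet> v) ` vertices j) = c \<bullet> v"
    proof (rule Max_eqI)
      fix b assume "b \<in> (\<lambda>v. c \<bullet> v) ` vertices j"
      then obtain w where w: "w \<in> vertices j" "b = c \<bullet> w" by auto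
      then have "(w, axis j 1) \<bullet> y \<ge> 0" using y(1) by blast
      then show "b \<le> c \<bullet> v" using v(2) w(2) unfolding in_y by simp
    qed (use v finite_vertices in auto)
    then show "\<exists>v' j'. (v, axis j 1) = (v', axis j' (1::real)) \<and> v' \<in> vertices j' \<and>
        c \<bullet> v' = Max ((\<lambda>v. c \<bullet> v) ` vertices j')"
      using v(1) by (intro exI[of _ v] exI[of _ j]) simp
  qed
  then show "independent {(v, axis j (1::real)) |v j. v \<in> vertices j \<and> (v, axis j 1) \<bullet> y = 0}"
    by (rule independent_mono[OF vertices_independent_max[OF c]])
qed

section \<open>Identification of the geometric complex with the combinatorial one\<close>

lemma cayley_polytope_eq: "cayley_polytope P S = convex hull verts S"
proof
  have layer: "P i \<times> {axis i 1} = convex hull layer i" for i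
    unfolding layer_def convex_hull_Times by (subst P_eq_hull) simp
  show "cayley_polytope P S \<subseteq> convex hull verts S"
    unfolding cayley_polytope_def
  proof (rule hull_minimal)
    show "(\<Union>i\<in>S. P i \<times> {axis i 1}) \<subseteq> convex hull verts S"
      unfolding layer by (intro UN_least hull_mono) (auto simp: verts_def)
  qed simp
  show "convex hull verts S \<subseteq> cayley_polytope P S"
    unfolding cayley_polytope_def verts_def layer
    by (intro hull_mono UN_mono hull_subset) simp
qed

lemma polytope_hull_verts: "polytope (convex hull verts S)"
  by (simp add: polytope_convex_hull)

lemma affine_independent_cplx: "\<sigma> \<in> cplx S \<Longrightarrow> \<not> affine_dependent \<sigma>"
  using independent_cplx affine_dependent_imp_dependent by blast

lemma hull_zero:
  assumes "y \<in> dual S"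
  shows "convex hull zero S y = convex hull verts S \<inter> {x. y \<bullet> x = 0}"
    and "convex hull zero S y face_of convex hull verts S"
proof -
  let ?F = "convex hull verts S \<inter> {x. y \<bullet> x = 0}"
  have "convex hull verts S \<subseteq> {x. y \<bullet> x \<ge> 0}"
  proof (rule hull_minimal)
    show "verts S \<subseteq> {x. y \<bullet> x \<ge> 0}" using assms by (auto simp: dual_def inner_commute)
  qed (rule convex_halfspace_ge)
  then have face: "?F face_of convex hull verts S"
    by (intro face_of_Int_supporting_hyperplane_ge) auto
  obtain S' where S': "S' \<subseteq> verts S" "?F = convex hull S'"
    using face_of_convex_hull_subset[OF _ face] finite_imp_compact[OF finite_verts] by metis
  have "S' \<subseteq> ?F" unfolding S'(2) by (rule hull_subset)
  then have "S' \<subseteq> zero S y" using S'(1) by (auto simp: zero_def inner_commute)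
  then have "?F \<subseteq> convex hull zero S y" unfolding S'(2) by (rule hull_mono)
  moreover have "convex hull zero S y \<subseteq> ?F"
  proof (rule hull_minimal)
    show "zero S y \<subseteq> ?F" by (auto simp: zero_def inner_commute intro: hull_inc)
    show "convex ?F" by (simp add: convex_Int convex_hyperplane)
  qed
  ultimately show eq: "convex hull zero S y = ?F" by blast
  show "convex hull zero S y face_of convex hull verts S" unfolding eq by (rule face)
qed

lemma hull_cplx_face:
  assumes "\<sigma> \<in> cplx S"
  shows "convex hull \<sigma> face_of convex hull verts S"
proof -
  obtain y where y: "y \<in> dual S" "fst y \<noteq> 0" "\<sigma> \<subseteq> zero S y" using assms by (auto simp: cplx_def)
  have "zero S y \<in> cplx S" using y by (intro cplxI) auto
  then have "convex hull \<sigma> face_of convex hull zero S y"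
    using face_of_convex_hull_affine_independent[OF affine_independent_cplx] y(3) by blast
  then show ?thesis using hull_zero(2)[OF y(1)] by (rule face_of_trans)
qed

lemma hull_cplx_inj: "inj_on (\<lambda>\<sigma>. convex hull \<sigma>) (cplx S)"
proof (rule inj_onI)
  have "\<sigma> = {v. v extreme_point_of (convex hull \<sigma>)}" if "\<sigma> \<in> cplx S" for \<sigma>
    using extreme_point_of_convex_hull_affine_independent[OF affine_independent_cplx[OF that]] by blast
  then show "\<sigma> = \<tau>" if "\<sigma> \<in> cplx S" "\<tau> \<in> cplx S" "convex hull \<sigma> = convex hull \<tau>" for \<sigma> \<tau>
    using that by metis
qed

lemma aff_dim_hull_cplx:
  assumes "\<sigma> \<in> cplx S"
  shows "aff_dim (convex hull \<sigma>) = int (card \<sigma>) - 1"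
  using aff_dim_affine_independent[OF affine_independent_cplx[OF assms]]
  by (simp add: aff_dim_convex_hull)

lemma simplex_eq: "snd ` (convex hull A) = convex hull (snd ` A)" for A :: "('a \<times> (real^'m)) set"
  by (rule convex_hull_linear_image) (rule linear_snd)

lemma snd_verts: "snd ` verts S = (\<lambda>i. axis i 1) ` S"
proof
  show "snd ` verts S \<subseteq> (\<lambda>i. axis i 1) ` S" by (auto simp: verts_def layer_def)
  show "(\<lambda>i. axis i 1) ` S \<subseteq> snd ` verts S"
  proof (intro image_subsetI)
    fix i assume i: "i \<in> S"
    obtain x where x: "x \<in> layer i" using layer_nonempty by blast
    then have "x \<in> verts S" "snd x = axis i 1" using i by (auto simp: verts_def layer_def)
    then show "axis i 1 \<in> snd ` verts S" by force
  qed
qed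

text \<open>A facet has vertices of all colours, so its hull projects onto the whole simplex and
  contains a point x0 over the relative interior. Moving any of its points slightly towards x0 stays
  in the facet and lands over the relative interior, which is what the closure in the carrier
  requires.\<close>

lemma facet_carrier:
  assumes F: "F \<in> facets S" and S: "S \<noteq> {}"
  shows "convex hull F \<subseteq> cayley_carrier P S"
proof -
  let ?\<Delta> = "convex hull ((\<lambda>i. axis i 1) ` S) :: (real^'m) set"
  define A where "A = snd -` rel_interior ?\<Delta> \<inter> rel_frontier (convex hull verts S)"
  have Fc: "F \<in> cplx S" using facetsD[OF F] by blast
  have "convex hull F \<noteq> convex hull verts S"
  proof
    assume same: "convex hull F = convex hull verts S"
    obtain j where "j \<in> S" using S by blast
    obtain x where x: "x \<in> layer j" "x \<bullet> normal S F \<noteq> 0"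
      using layer_nonconstant[OF normal(2)[OF F]] by blast
    have "x \<in> convex hull verts S" using x \<open>j \<in> S\<close> by (intro hull_inc) (auto simp: verts_def)
    then have "x \<in> convex hull zero S (normal S F)" using same normal(3)[OF F] by simp
    then show False unfolding hull_zero(1)[OF normal(1)[OF F]] using x(2) by (simp add: inner_commute)
  qed
  then have frontier: "convex hull F \<subseteq> rel_frontier (convex hull verts S)"
    using hull_cplx_face[OF Fc] by (intro face_of_subset_rel_frontier)
  have "snd ` F = (\<lambda>i. axis i 1) ` S"
  proof
    show "snd ` F \<subseteq> (\<lambda>i. axis i 1) ` S" using snd_verts facetsD[OF F] by blast
    show "(\<lambda>i. axis i 1) ` S \<subseteq> snd ` F"
    proof (intro image_subsetI)
      fix i assume "i \<in> S"
      then obtain x where "x \<in> F" "x \<in> layer i" using facet_layer[OF F] by blast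
      then show "axis i 1 \<in> snd ` F" by (force simp: layer_def)
    qed
  qed
  then have sndF: "snd ` (convex hull F) = ?\<Delta>" by (simp add: simplex_eq)
  have "rel_interior ?\<Delta> \<noteq> {}" using S by (simp add: rel_interior_eq_empty)
  then obtain s0 where s0: "s0 \<in> rel_interior ?\<Delta>" by blast
  then have "s0 \<in> snd ` (convex hull F)" using sndF rel_interior_subset by blast
  then obtain x0 where x0: "x0 \<in> convex hull F" "snd x0 = s0" by blast
  have "x \<in> closure A" if x: "x \<in> convex hull F" for x
  proof -
    define g where "g t = x - t *\<^sub>R (x - x0)" for t :: real
    have "g t \<in> A" if t: "0 < t" "t \<le> 1" for t
    proof -
      have "snd x \<in> ?\<Delta>" using x sndF by blast
      then have "snd x - t *\<^sub>R (snd x - s0) \<in> rel_interior ?\<Delta>"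
        using rel_interior_convex_shrink[OF convex_convex_hull s0 _ t] by blast
      moreover have "g t \<in> convex hull F"
      proof -
        have "g t = (1 - t) *\<^sub>R x + t *\<^sub>R x0" by (simp add: g_def algebra_simps)
        then show ?thesis using convexD_alt[OF convex_convex_hull x x0(1), of t] t by simp
      qed
      ultimately show ?thesis using frontier by (auto simp: A_def g_def x0(2))
    qed
    then have "eventually (\<lambda>t. g t \<in> closure A) (at_right 0)"
      unfolding eventually_at_right_field using closure_subset by (intro exI[of _ 1]) fastforce
    moreover have "(g \<longlongrightarrow> g 0) (at_right 0)" unfolding g_def by (intro tendsto_intros)
    ultimately have "g 0 \<in> closure A"
      by (intro Lim_in_closed_set[of "closure A" g "at_right 0" "g 0"]) (auto simp: trivial_limit_at_right_real)
    then show ?thesis by (simp add: g_def)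
  qed
  then show ?thesis unfolding cayley_carrier_def cayley_polytope_eq A_def by blast
qed

text \<open>A boundary point over the relative interior of the simplex lies on an exposed face, and
  its functional has a nonzero first component. The union on the right is closed, being finite, so
  it also contains the closure.\<close>

lemma carrier_covered:
  assumes S: "S \<noteq> {}"
  shows "cayley_carrier P S \<subseteq> (\<Union>\<sigma>\<in>cplx S. convex hull \<sigma>)"
proof -
  let ?\<Delta> = "convex hull ((\<lambda>i. axis i 1) ` S) :: (real^'m) set" and ?C = "convex hull verts S"
  have "snd -` rel_interior ?\<Delta> \<inter> rel_frontier ?C \<subseteq> (\<Union>\<sigma>\<in>cplx S. convex hull \<sigma>)"
  proof
    fix x assume "x \<in> snd -` rel_interior ?\<Delta> \<inter> rel_frontier ?C"
    then have x\<Delta>: "snd x \<in> rel_interior ?\<Delta>" and "x \<in> rel_frontier ?C" by auto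
    then obtain F where F: "F facet_of ?C" "x \<in> F"
      using rel_frontier_of_polyhedron[OF polytope_imp_polyhedron[OF polytope_hull_verts]] by blast
    have "F \<noteq> ?C" using F(1) by (auto simp: facet_of_def)
    have face: "F face_of ?C" using F(1) by (simp add: facet_of_def)
    then have "F exposed_face_of ?C"
      by (simp add: exposed_face_of_polyhedron polytope_imp_polyhedron polytope_hull_verts)
    then obtain a b where ab: "?C \<subseteq> {x. a \<bullet> x \<le> b}" "F = ?C \<inter> {x. a \<bullet> x = b}"
      using F(2) \<open>F \<noteq> ?C\<close> unfolding exposed_face_of by blast
    \<comment> \<open>The colour coordinates sum to one on the polytope, so the constant b can be
      absorbed into them: y is a linear form equal to b - a there.\<close>
    define y where "y = (- fst a, (\<chi> j. b - snd a $ j))"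
    have "verts S \<subseteq> {x. (y + a) \<bullet> x = b}"
    proof
      fix z assume "z \<in> verts S"
      then obtain j where "z \<in> layer j" by (auto simp: verts_def)
      then show "z \<in> {x. (y + a) \<bullet> x = b}" by (simp add: inner_commute[of _ z] layer_inner y_def)
    qed
    then have "?C \<subseteq> {x. (y + a) \<bullet> x = b}" by (rule hull_minimal) (rule convex_hyperplane)
    then have ya: "y \<bullet> z = b - a \<bullet> z" if "z \<in> ?C" for z
      using that by (auto simp: inner_add_left)
    have yge: "y \<bullet> z \<ge> 0" if "z \<in> ?C" for z using ya[OF that] ab(1) that by auto
    then have yd: "y \<in> dual S" unfolding dual_def
      by (auto simp: inner_commute[of _ y] intro: hull_inc)
    \<comment> \<open>Otherwise y is a functional of the simplex alone, nonnegative on it and zero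
      at a relative interior point; it then vanishes on the whole simplex, and F would be the whole
      polytope.\<close>
    have "fst y \<noteq> 0"
    proof
      assume y0: "fst y = 0"
      then have ys: "y \<bullet> z = snd y \<bullet> snd z" for z by (simp add: inner_prod_def)
      have sndC: "snd ` ?C = ?\<Delta>" unfolding simplex_eq snd_verts ..
      have "?\<Delta> \<inter> {s. snd y \<bullet> s = 0} face_of ?\<Delta>"
      proof (rule face_of_Int_supporting_hyperplane_ge)
        fix s assume "s \<in> ?\<Delta>"
        then obtain z where "z \<in> ?C" "s = snd z" using sndC by blast
        then show "snd y \<bullet> s \<ge> 0" using yge ys by metis
      qed simp
      moreover have "snd x \<in> ?\<Delta> \<inter> {s. snd y \<bullet> s = 0}"
      proof -
        have "x \<in> ?C" "a \<bullet> x = b" using F(2) ab(2) by auto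
        then have "y \<bullet> x = 0" using ya by simp
        then show ?thesis using ys x\<Delta> rel_interior_subset by auto
      qed
      ultimately have "?\<Delta> \<subseteq> {s. snd y \<bullet> s = 0}"
        using subset_of_face_of[of "?\<Delta> \<inter> {s. snd y \<bullet> s = 0}" ?\<Delta> ?\<Delta>] x\<Delta> by blast
      then have "snd y \<bullet> snd z = 0" if "z \<in> ?C" for z using sndC that by blast
      then have "a \<bullet> z = b" if "z \<in> ?C" for z using ya[OF that] ys[of z] that by simp
      then have "F = ?C" unfolding ab(2) by blast
      then show False using \<open>F \<noteq> ?C\<close> by blast
    qed
    then have "zero S y \<in> cplx S" using yd by (intro cplxI) auto
    moreover have "x \<in> convex hull zero S y"
    proof -
      have "x \<in> ?C" "a \<bullet> x = b" using F(2) ab(2) by auto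
      then show ?thesis unfolding hull_zero(1)[OF yd] using ya by simp
    qed
    ultimately show "x \<in> (\<Union>\<sigma>\<in>cplx S. convex hull \<sigma>)" by blast
  qed
  moreover have "closed (\<Union>\<sigma>\<in>cplx S. convex hull \<sigma>)"
  proof (rule closed_UN[OF finite_cplx], rule ballI)
    fix \<sigma> assume "\<sigma> \<in> cplx S"
    then have "finite \<sigma>" using cplx_subset finite_subset[OF _ finite_verts] by blast
    then show "closed (convex hull \<sigma>)" by (simp add: finite_imp_compact_convex_hull compact_imp_closed)
  qed
  ultimately show ?thesis unfolding cayley_carrier_def cayley_polytope_eq by (rule closure_minimal)
qed

text \<open>A relative interior point of a face F in the carrier lies in the hull of some \<sigma>
  in \<open>cplx S\<close>. This hull is a face of the polytope, so it contains F, and it is a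
  simplex, so F is the hull of a subset. Conversely, each \<sigma> lies in a facet, whose hull is in
  the carrier. The empty family has no facets to use and is treated directly.\<close>

lemma cayley_complex_eq: "cayley_complex P S = (\<lambda>\<sigma>. convex hull \<sigma>) ` cplx S"
proof (cases "S = {}")
  case True
  have "cplx {} = {{}}"
    using empty_in_cplx[of "{}"] cplx_subset[of _ "{}"] by (auto simp: verts_def)
  then show ?thesis using True by (simp add: cayley_complex_empty)
next
  case False
  show ?thesis
  proof (intro subset_antisym subsetI)
    fix F assume "F \<in> cayley_complex P S"
    then have F: "F face_of convex hull verts S" "F \<subseteq> cayley_carrier P S"
      by (simp_all add: cayley_complex_def cayley_polytope_eq)
    show "F \<in> (\<lambda>\<sigma>. convex hull \<sigma>) ` cplx S"
    proof (cases "F = {}")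
      case True
      then show ?thesis using empty_in_cplx by (intro image_eqI[of _ _ "{}"]) auto
    next
      case F0: False
      then have "rel_interior F \<noteq> {}" using face_of_imp_convex[OF F(1)] by (simp add: rel_interior_eq_empty)
      then obtain z where z: "z \<in> rel_interior F" by blast
      then have "z \<in> cayley_carrier P S" using F(2) rel_interior_subset by blast
      then obtain \<sigma> where \<sigma>: "\<sigma> \<in> cplx S" "z \<in> convex hull \<sigma>" using carrier_covered[OF False] by blast
      have "F \<subseteq> convex hull \<sigma>"
        using subset_of_face_of[OF hull_cplx_face[OF \<sigma>(1)] face_of_imp_subset[OF F(1)]] z \<sigma>(2) by blast
      then have "F face_of convex hull \<sigma>"
        using face_of_subset[OF F(1)] face_of_imp_subset[OF hull_cplx_face[OF \<sigma>(1)]] by blast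
      then obtain \<tau> where "\<tau> \<subseteq> \<sigma>" "F = convex hull \<tau>"
        using face_of_convex_hull_affine_independent[OF affine_independent_cplx[OF \<sigma>(1)]] by blast
      then show ?thesis using cplx_down[OF \<sigma>(1)] by blast
    qed
  next
    fix F assume "F \<in> (\<lambda>\<sigma>. convex hull \<sigma>) ` cplx S"
    then obtain \<sigma> where \<sigma>: "\<sigma> \<in> cplx S" "F = convex hull \<sigma>" by blast
    obtain F' where F': "F' \<in> facets S" "\<sigma> \<subseteq> F'" using in_facet[OF \<sigma>(1) False] by blast
    have "F \<subseteq> convex hull F'" unfolding \<sigma>(2) using F'(2) by (rule hull_mono)
    then have "F \<subseteq> cayley_carrier P S" using facet_carrier[OF F'(1) False] by blast
    then show "F \<in> cayley_complex P S"
      using hull_cplx_face[OF \<sigma>(1)] by (simp add: cayley_complex_def cayley_polytope_eq \<sigma>(2))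
  qed
qed

lemma cayley_relative_eq: "cayley_complex P S - cayley_sub P S = (\<lambda>\<sigma>. convex hull \<sigma>) ` mixed S"
proof -
  have sub: "\<sigma> \<in> cplx (S - {i}) \<longleftrightarrow> \<sigma> \<in> cplx S \<and> \<sigma> \<inter> layer i = {}" if "i \<in> S" for i \<sigma>
  proof -
    have "\<sigma> \<subseteq> verts (S - {i}) \<longleftrightarrow> \<sigma> \<inter> layer i = {}" if "\<sigma> \<subseteq> verts S"
      using that verts_layer[of _ "S - {i}" i] by (fastforce simp: verts_def)
    then show ?thesis
      using cplx_eq[of \<sigma> S] cplx_eq[of \<sigma> "S - {i}"] verts_mono[of "S - {i}" S] by blast
  qed
  have "cayley_sub P S = (\<lambda>\<sigma>. convex hull \<sigma>) ` (cplx S - mixed S)"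
    unfolding cayley_sub_def cayley_complex_eq image_UN[symmetric]
  proof (rule arg_cong[where f="(`) _"])
    show "(\<Union>i\<in>S. cplx (S - {i})) = cplx S - mixed S" using sub unfolding mixed_def by auto
  qed
  moreover have "mixed S \<subseteq> cplx S" by (auto simp: mixed_def)
  moreover from this have "cplx S - (cplx S - mixed S) = mixed S" by blast
  ultimately show ?thesis
    unfolding cayley_complex_eq
    using inj_on_image_set_diff[OF hull_cplx_inj[of S], of "cplx S" "cplx S - mixed S"] by simp
qed

section \<open>Translation of face numbers, vertices and non-faces\<close>

lemma card_faces:
  assumes "\<A> \<subseteq> cplx S"
  shows "card {F \<in> (\<lambda>\<sigma>. convex hull \<sigma>) ` \<A>. aff_dim F = int k - 1} = card {\<sigma> \<in> \<A>. card \<sigma> = k}"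
proof -
  have "{F \<in> (\<lambda>\<sigma>. convex hull \<sigma>) ` \<A>. aff_dim F = int k - 1} =
      (\<lambda>\<sigma>. convex hull \<sigma>) ` {\<sigma> \<in> \<A>. card \<sigma> = k}"
    using assms aff_dim_hull_cplx by (auto simp: subset_iff)
  then show ?thesis
    using inj_on_subset[OF hull_cplx_inj[of S], of "{\<sigma> \<in> \<A>. card \<sigma> = k}"] assms
    by (simp add: card_image subset_iff)
qed

lemma h_poly_eq: "h_poly (DIM('a) + card S - 1) (cayley_complex P S) (cayley_sub P S) = h S"
proof -
  define D where "D = DIM('a) + card S - 1"
  let ?q = "[:1, -1:] :: int poly"
  have sub: "mixed S \<subseteq> cplx S" by (auto simp: mixed_def)
  have "card \<sigma> \<le> D" if "\<sigma> \<in> mixed S" for \<sigma>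
    using card_cplx[of \<sigma> S] sub that by (auto simp: D_def)
  then have groups: "(\<Sum>k\<le>D. \<Sum>\<sigma> | \<sigma> \<in> mixed S \<and> card \<sigma> = k. monom 1 (card \<sigma>) * ?q ^ (D - card \<sigma>)) =
      (\<Sum>\<sigma>\<in>mixed S. monom 1 (card \<sigma>) * ?q ^ (D - card \<sigma>))"
    by (intro sum.group) (auto simp: finite_mixed)
  have group: "(\<Sum>\<sigma> | \<sigma> \<in> mixed S \<and> card \<sigma> = k. monom 1 (card \<sigma>) * ?q ^ (D - card \<sigma>)) =
      monom (int (card {\<sigma> \<in> mixed S. card \<sigma> = k})) k * ?q ^ (D - k)" for k
  proof -
    have "(\<Sum>\<sigma> | \<sigma> \<in> mixed S \<and> card \<sigma> = k. monom 1 (card \<sigma>) * ?q ^ (D - card \<sigma>)) =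
        (\<Sum>\<sigma> | \<sigma> \<in> mixed S \<and> card \<sigma> = k. monom 1 k * ?q ^ (D - k))" by (intro sum.cong) auto
    also have "\<dots> = of_nat (card {\<sigma> \<in> mixed S. card \<sigma> = k}) * (monom 1 k * ?q ^ (D - k))" by simp
    also have "\<dots> = monom (int (card {\<sigma> \<in> mixed S. card \<sigma> = k})) k * ?q ^ (D - k)"
      by (simp add: of_nat_poly smult_monom flip: mult_smult_left)
    finally show ?thesis .
  qed
  show ?thesis
    unfolding h_poly_def f_num_def cayley_relative_eq card_faces[OF sub] h_def face_poly_def D_def[symmetric]
    by (simp only: group[symmetric] groups)
qed

lemma cayley_h_eq: "cayley_h P S k = h_coeff S k"
  unfolding cayley_h_def h_num_def h_poly_eq h_coeff_def ..

lemma cayley_g_eq: "cayley_g P S k = g_coeff S k"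
  unfolding cayley_g_def g_num_def h_num_def h_poly_eq g_coeff_def h_coeff_def ..

lemma singleton_cplx: "{x} \<in> cplx S \<longleftrightarrow> x \<in> verts S"
  using vertex_in_cplx[of x S] cplx_subset[of "{x}" S] by auto

lemma cayley_f0_eq: "cayley_f0 P S = int (card (verts S))"
proof -
  have "{\<sigma> \<in> cplx S. card \<sigma> = 1} = (\<lambda>x. {x}) ` verts S"
    using singleton_cplx[of _ S] by (auto simp: card_1_singleton_iff)
  then have "card {\<sigma> \<in> cplx S. card \<sigma> = 1} = card (verts S)" by (simp add: card_image)
  then show ?thesis
    using card_faces[of "cplx S" S 1] by (simp add: cayley_f0_def f_num_def cayley_complex_eq)
qed

lemma complex_vertices_eq: "complex_vertices (cayley_complex P S) = verts S"
proof -
  have "{x} \<in> (\<lambda>\<sigma>. convex hull \<sigma>) ` cplx S \<longleftrightarrow> {x} \<in> cplx S" for x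
  proof
    assume "{x} \<in> (\<lambda>\<sigma>. convex hull \<sigma>) ` cplx S"
    then obtain \<sigma> where \<sigma>: "\<sigma> \<in> cplx S" "convex hull \<sigma> = {x}" by auto
    then have "\<sigma> \<subseteq> {x}" "\<sigma> \<noteq> {}" using hull_subset[of \<sigma> convex] by auto
    then show "{x} \<in> cplx S" using \<sigma>(1) by (simp add: subset_singleton_iff)
  next
    assume "{x} \<in> cplx S"
    then show "{x} \<in> (\<lambda>\<sigma>. convex hull \<sigma>) ` cplx S" by (intro image_eqI[of _ _ "{x}"]) auto
  qed
  then show ?thesis by (simp add: complex_vertices_def cayley_complex_eq singleton_cplx)
qed

lemma non_face_eq: "non_face (cayley_complex P S) \<sigma> \<longleftrightarrow> \<sigma> \<subseteq> verts S \<and> \<sigma> \<notin> cplx S"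
proof -
  have "{v. v extreme_point_of (convex hull \<tau>)} = \<tau>" if "\<tau> \<in> cplx S" for \<tau>
    using extreme_point_of_convex_hull_affine_independent[OF affine_independent_cplx[OF that]] by blast
  then have "(\<exists>F\<in>cayley_complex P S. {v. v extreme_point_of F} = \<sigma>) \<longleftrightarrow> \<sigma> \<in> cplx S"
    unfolding cayley_complex_eq by auto
  then show ?thesis by (simp add: non_face_def complex_vertices_eq)
qed

lemma verts_singleton: "verts {i} = layer i"
  by (simp add: verts_def)

lemma excess_cayley:
  "excess S k = (cayley_f0 P S - int DIM('a) - int (card S)) * cayley_h P S k
     + (\<Sum>j\<in>S. cayley_f0 P {j} * cayley_g P (S - {j}) k) - (k + 1) * cayley_g P S (k + 1)"
  by (simp add: excess_def cayley_f0_eq cayley_h_eq cayley_g_eq verts_singleton)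

end

theorem theorem5p10:
  fixes P :: "'m::finite \<Rightarrow> (real^'d) set" and k0 :: int
  assumes "\<And>i. simplicial_polytope (P i)"
    and "\<And>i. aff_dim (P i) = int CARD('d)"
    and "relatively_general_position P"
  shows "(\<forall>k::int.
            (k + int CARD('m)) * cayley_g P UNIV (k + int CARD('m))
            \<le> (cayley_f0 P UNIV - int CARD('d) - int CARD('m))
                 * cayley_h P UNIV (k + int CARD('m) - 1)
              + (\<Sum>i\<in>UNIV. cayley_f0 P {i} * cayley_g P (UNIV - {i}) (k + int CARD('m) - 1)))
       \<and> ((\<forall>i\<le>k0. \<forall>S::'m set.
            (i + int (card S)) * cayley_g P S (i + int (card S))
            = (cayley_f0 P S - int CARD('d) - int (card S))
                 * cayley_h P S (i + int (card S) - 1)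
              + (\<Sum>j\<in>S. cayley_f0 P {j} * cayley_g P (S - {j}) (i + int (card S) - 1)))
          \<longleftrightarrow> (\<forall>S::'m set. \<forall>\<sigma>.
                 non_face (cayley_complex P S) \<sigma> \<and> int (card \<sigma>) - 1 < k0 + int (card S)
                 \<longrightarrow> (\<exists>R. R \<subset> S \<and> \<sigma> \<subseteq> complex_vertices (cayley_complex P R))))"
proof -
  interpret simplicial_family P by unfold_locales (use assms in auto)
  \<comment> \<open>The shift k + |S| - 1 turns the factor k + 1 of \<open>excess\<close> into k +
    |S|; S = UNIV gives the inequality for the whole family.\<close>
  have ex: "excess S (k + int (card S) - 1) =
      (cayley_f0 P S - int CARD('d) - int (card S)) * cayley_h P S (k + int (card S) - 1)
      + (\<Sum>j\<in>S. cayley_f0 P {j} * cayley_g P (S - {j}) (k + int (card S) - 1))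
      - (k + int (card S)) * cayley_g P S (k + int (card S))" for S k
    unfolding excess_cayley by simp
  have "(k + int (card S)) * cayley_g P S (k + int (card S)) \<le>
      (cayley_f0 P S - int CARD('d) - int (card S)) * cayley_h P S (k + int (card S) - 1)
      + (\<Sum>j\<in>S. cayley_f0 P {j} * cayley_g P (S - {j}) (k + int (card S) - 1))" for S k
    using excess_nonneg[of S "k + int (card S) - 1"] unfolding ex by simp
  moreover have "(k + int (card S)) * cayley_g P S (k + int (card S)) =
      (cayley_f0 P S - int CARD('d) - int (card S)) * cayley_h P S (k + int (card S) - 1)
      + (\<Sum>j\<in>S. cayley_f0 P {j} * cayley_g P (S - {j}) (k + int (card S) - 1))
      \<longleftrightarrow> excess S (k + int (card S) - 1) = 0" for S k
    unfolding ex by auto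
  ultimately show ?thesis
    using excess_zero_iff_faces[of k0] by (simp only: non_face_eq complex_vertices_eq conj_assoc) simp
qed

end
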